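(* Let $\theta\in\mathbb{R}$. The isomorphism $\overline{\varphi}_\theta\colon\Omega^1(A_\theta)\to\Omega^1(A)_\theta$, $a\,\mathrm{d}_\theta a'\mapsto a\star_\theta\mathrm{d}a'$, defines (by restriction) a bijection $$\overline{\varphi}_\theta\colon\mathrm{Con}(A_\theta,\delta)\longrightarrow\mathrm{Con}(A,\delta),\qquad\omega_\theta\longmapsto\overline{\varphi}_\theta(\omega_\theta),$$ between the set of connections on the deformed Hopf fibration $(A_\theta,\delta)$ and the set of connections on the classical Hopf fibration $(A,\delta)$.
   Context: Algebras are associative and unital over $\mathbb{C}$, $\otimes=\otimes_{\mathbb{C}}$. Sweedler notation: $\delta(a)=a_{\underline{0}}\otimes a_{\underline{1}}$ for right coactions, $\rho(a)=a_{\underline{-1}}\otimes a_{\underline{0}}$ for left coactions. $A=\mathcal{O}(\mathbb{S}^3)$ is the commutative $\ast$-algebra generated by $z_1,z_2$ modulo the $\ast$-ideal generated by the relation $z_1^\ast z_1+z_2^\ast z_2=\mathbf{1}$. $H=\mathcal{O}(U(1))$ is the commutative $\ast$-Hopf algebra generated by $t$ with $t^\ast t=\mathbf{1}$, $\Delta(t)=t\otimes t$, $\epsilon(t)=1$, $S(t)=t^\ast$. $\delta\colon A\to A\otimes H$ is the right $H$-coaction ($\ast$-algebra map) with $\delta(z_i)=z_i\otimes t$, $\delta(z_i^\ast)=z_i^\ast\otimes t^\ast$. $K=\mathcal{O}(\mathbb{T}^2)$ is the Hopf algebra with basis $\{t_{\mathbf m}:\mathbf m\in\mathbb{Z}^2\}$,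 $t_{\mathbf m}t_{\mathbf m'}=t_{\mathbf m+\mathbf m'}$, $\Delta(t_{\mathbf m})=t_{\mathbf m}\otimes t_{\mathbf m}$, $\epsilon(t_{\mathbf m})=1$, $S(t_{\mathbf m})=t_{\mathbf m}^\ast=t_{-\mathbf m}$. $\rho\colon A\to K\otimes A$ is the left $K$-coaction ($\ast$-algebra map) with $\rho(z_1)=t_{(1,0)}\otimes z_1$, $\rho(z_2)=t_{(0,1)}\otimes z_2$, $\rho(z_1^\ast)=t_{(-1,0)}\otimes z_1^\ast$, $\rho(z_2^\ast)=t_{(0,-1)}\otimes z_2^\ast$. For $\theta\in\mathbb{R}$ let $\sigma_\theta(t_{\mathbf m}\otimes t_{\mathbf m'})=\exp(\pi i\theta(m_1m_2'-m_2m_1'))$ and $R_\theta=\sigma_\theta^{-2}$, i.e. $R_\theta(t_{\mathbf m}\otimes t_{\mathbf m'})=\exp(-2\pi i\theta(m_1m_2'-m_2m_1'))$. $A_\theta$ is the same vector space with the same unit, involution and coactions, and product $a\star_\theta a'=\sigma_\theta(a_{\underline{-1}}\otimes a'_{\underline{-1}})\,a_{\underline 0}a'_{\underline 0}$. Kähler forms: $\Omega^1(A)=\ker\mu_A/(\ker\mu_A)^2$, where $\mu_A\colon A\otimes A\to A$ is the product and $(\ker\mu_A)^2$ is formed in the tensor product algebra $A\otimes A$; $\mathrm{d}a$ is the class of $\mathbf 1\otimes a-a\otimes\mathbf 1$. Similarly $\Omega^1(A_\theta)=\ker\mu_{A_\theta}/(\ker\mu_{A_\theta})^2$, where the square is formed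 in $A_\theta\otimes A_\theta$ with the braided tensor algebra product $(a\otimes a')(\tilde a\otimes\tilde a')=R_\theta(\tilde a_{\underline{-1}}\otimes a'_{\underline{-1}})(a\star_\theta\tilde a_{\underline 0})\otimes(a'_{\underline 0}\star_\theta\tilde a')$; $\mathrm{d}_\theta a$ is the class of $\mathbf 1\otimes a-a\otimes\mathbf 1$. Both carry left $K$- and right $H$-coactions induced by the tensor product coactions. $\Omega^1(A)_\theta$ is the $(K,H)$-bicomodule $\Omega^1(A)$ (same vector space) with left $A_\theta$-action $a\star_\theta\lambda=\sigma_\theta(a_{\underline{-1}}\otimes\lambda_{\underline{-1}})\,a_{\underline 0}\lambda_{\underline 0}$. Connections: let $X\colon H\to\mathbb{C}$ be the $\epsilon$-derivation $X(t^n)=n$, a basis of $\mathfrak h=\mathrm{Der}_\epsilon(H)\cong\mathbb{C}$. Define $\overline{\mathrm{ver}}^X\colon\Omega^1(A)\to A$, $\overline{\mathrm{ver}}^X(a\,\mathrm{d}a')=a\,a'_{\underline 0}X(a'_{\underline 1})$ and $\overline{\mathrm{ver}}^X_\theta\colon\Omega^1(A_\theta)\to A_\theta$, $\overline{\mathrm{ver}}^X_\theta(a\,\mathrm{d}_\theta a')=a\star_\theta a'_{\underline 0}X(a'_{\underline 1})$. The set of connections (identified with connection forms) is $\mathrm{Con}(A,\delta)=\{\omega\in\Omega^1(A)^{\mathrm{co}H}:\overline{\mathrm{ver}}^X(\omega)=\mathbf 1\}$ and $\mathrm{Con}(A_\theta,\delta)=\{\omega_\theta\in\Omega^1(A_\theta)^{\mathrm{co}H}:\overline{\mathrm{ver}}^X_\theta(\omega_\theta)=\mathbf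 1\}$, where $(-)^{\mathrm{co}H}$ denotes $H$-coinvariant elements. *)

theory Defs
  imports Complex_Main "HOL-Library.Poly_Mapping" "HOL-Library.Product_Plus"
begin

section \<open>Complex vector spaces and commutative algebras\<close>

class complex_vector = ab_group_add +
  fixes scaleC :: "complex \<Rightarrow> 'a \<Rightarrow> 'a"  (infixr \<open>*\<^sub>C\<close> 75)
  assumes scaleC_add_right: "c *\<^sub>C (x + y) = c *\<^sub>C x + c *\<^sub>C y"
    and scaleC_add_left: "(c + d) *\<^sub>C x = c *\<^sub>C x + d *\<^sub>C x"
    and scaleC_scaleC: "c *\<^sub>C d *\<^sub>C x = (c * d) *\<^sub>C x"
    and scaleC_one: "1 *\<^sub>C x = x"

global_interpretation cvec: vector_space "scaleC :: complex \<Rightarrow> 'a \<Rightarrow> 'a::complex_vector"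
  by unfold_locales (simp_all add: scaleC_add_right scaleC_add_left scaleC_scaleC scaleC_one)

abbreviation cspan :: "'a::complex_vector set \<Rightarrow> 'a set" where
  "cspan \<equiv> module.span scaleC"

abbreviation clinear :: "('a::complex_vector \<Rightarrow> 'b::complex_vector) \<Rightarrow> bool" where
  "clinear \<equiv> Vector_Spaces.linear scaleC scaleC"

global_interpretation cvec_pair: vector_space_pair
  "scaleC :: complex \<Rightarrow> 'a \<Rightarrow> 'a::complex_vector" "scaleC :: complex \<Rightarrow> 'b \<Rightarrow> 'b::complex_vector"
  by unfold_locales

lemma clinearI:
  assumes "\<And>x y. f (x + y) = f x + f y" "\<And>c x. f (c *\<^sub>C x) = c *\<^sub>C f x"
  shows "clinear f"
  by (intro Vector_Spaces.linear.intro module_hom.intro module_hom_axioms.intro)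
    (unfold_locales, simp_all add: assms)

lemma
  assumes "clinear f"
  shows clinear_add: "f (x + y) = f x + f y"
    and clinear_scale: "f (c *\<^sub>C x) = c *\<^sub>C f x"
    and clinear_0: "f 0 = 0"
    and clinear_minus: "f (- x) = - f x"
    and clinear_diff: "f (x - y) = f x - f y"
    and clinear_sum: "f (sum g S) = (\<Sum>i\<in>S. f (g i))"
  using assms by (simp_all add: cvec_pair.linear_add cvec_pair.linear_scale
      cvec_pair.linear_0 cvec_pair.linear_neg cvec_pair.linear_diff cvec_pair.linear_sum)

lemmas clinear_simps = clinear_add clinear_scale clinear_0 clinear_minus clinear_diff clinear_sum

lemma clinear_compose: "clinear f \<Longrightarrow> clinear g \<Longrightarrow> clinear (\<lambda>x. f (g x))"
  by (intro clinearI) (simp_all add: clinear_simps)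

definition cbilinear :: "('a::complex_vector \<Rightarrow> 'b::complex_vector \<Rightarrow> 'c::complex_vector) \<Rightarrow> bool"
  where "cbilinear f \<longleftrightarrow> (\<forall>b. clinear (\<lambda>a. f a b)) \<and> (\<forall>a. clinear (f a))"

text \<open>The axiom \<open>0 \<noteq> 1\<close> of \<^class>\<open>comm_ring_1\<close> is not imposed, so that tensor products are
  again instances.\<close>

class complex_comm_algebra = complex_vector + comm_ring + comm_monoid_mult +
  assumes mult_scaleC_left: "(c *\<^sub>C x) * y = c *\<^sub>C (x * y)"

lemma mult_scaleC_right: "x * (c *\<^sub>C y) = c *\<^sub>C (x * (y::'a::complex_comm_algebra))"
  by (metis mult.commute mult_scaleC_left)

instantiation complex :: complex_comm_algebra
begin
definition scaleC_complex :: "complex \<Rightarrow> complex \<Rightarrow> complex" where "scaleC_complex c x = c * x"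
instance by standard (simp_all add: scaleC_complex_def algebra_simps)
end

instantiation poly_mapping :: (type, complex_vector) complex_vector
begin
lift_definition scaleC_poly_mapping :: "complex \<Rightarrow> ('a \<Rightarrow>\<^sub>0 'b) \<Rightarrow> ('a \<Rightarrow>\<^sub>0 'b)"
  is "\<lambda>c f k. c *\<^sub>C f k"
  by (rule finite_subset) auto
instance
  by standard (transfer, simp add: fun_eq_iff scaleC_add_right scaleC_add_left scaleC_scaleC scaleC_one)+
end

lemma lookup_scaleC: "Poly_Mapping.lookup (c *\<^sub>C p) k = c *\<^sub>C Poly_Mapping.lookup p k"
  by transfer simp

lemma scaleC_single: "c *\<^sub>C Poly_Mapping.single k x = Poly_Mapping.single k (c *\<^sub>C x)"
  by (rule poly_mapping_eqI) (simp add: lookup_scaleC lookup_single when_def)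

lemma scaleC_eq_single_mult: "c *\<^sub>C p = Poly_Mapping.single 0 c * (p :: 'a::monoid_add \<Rightarrow>\<^sub>0 complex)"
  by (rule poly_mapping_eqI)
    (simp add: lookup_scaleC scaleC_complex_def flip: mult_map_scale_conv_mult, transfer, simp add: when_def)

instance poly_mapping :: (comm_monoid_add, "{comm_ring_1, complex_comm_algebra}") complex_comm_algebra
proof
  fix c :: complex and x y :: "'a \<Rightarrow>\<^sub>0 'b"
  have *: "d *\<^sub>C z = Poly_Mapping.single 0 (d *\<^sub>C 1) * z" for d and z :: "'a \<Rightarrow>\<^sub>0 'b"
    by (rule poly_mapping_eqI)
      (simp add: lookup_scaleC flip: mult_map_scale_conv_mult mult_scaleC_left, transfer,
        simp add: when_def mult_scaleC_left)
  show "c *\<^sub>C x * y = c *\<^sub>C (x * y)"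
    by (simp only: * mult.assoc)
qed

text \<open>Linear extension of a map given on the basis \<open>(Poly_Mapping.single k 1)\<^sub>k\<close>.\<close>

definition lin_ext :: "('k \<Rightarrow> 'v::complex_vector) \<Rightarrow> ('k \<Rightarrow>\<^sub>0 complex) \<Rightarrow> 'v" where
  "lin_ext f p = (\<Sum>k\<in>Poly_Mapping.keys p. Poly_Mapping.lookup p k *\<^sub>C f k)"

lemma lin_ext_superset:
  "finite S \<Longrightarrow> Poly_Mapping.keys p \<subseteq> S \<Longrightarrow> lin_ext f p = (\<Sum>k\<in>S. Poly_Mapping.lookup p k *\<^sub>C f k)"
  unfolding lin_ext_def by (rule sum.mono_neutral_left) (auto simp: in_keys_iff)

lemma lin_ext_clinear: "clinear (lin_ext f)"
proof (rule clinearI)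
  fix p q :: "'a \<Rightarrow>\<^sub>0 complex" and c
  let ?S = "Poly_Mapping.keys p \<union> Poly_Mapping.keys q"
  have "finite ?S" by simp
  then show "lin_ext f (p + q) = lin_ext f p + lin_ext f q"
    using keys_add[of p q]
    by (simp add: lin_ext_superset[of ?S] lookup_add scaleC_add_left sum.distrib)
  have "Poly_Mapping.keys (c *\<^sub>C p) \<subseteq> Poly_Mapping.keys p"
    by (auto simp: in_keys_iff lookup_scaleC)
  then show "lin_ext f (c *\<^sub>C p) = c *\<^sub>C lin_ext f p"
    by (simp add: lin_ext_superset[of "Poly_Mapping.keys p"] lookup_scaleC scaleC_complex_def
        cvec.scale_sum_right scaleC_scaleC)
qed

lemma lin_ext_single [simp]: "lin_ext f (Poly_Mapping.single k c) = c *\<^sub>C f k"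
  by (cases "c = 0") (simp_all add: lin_ext_def)

lemma poly_mapping_decomp: "p = lin_ext (\<lambda>k. Poly_Mapping.single k 1) p"
proof (rule poly_mapping_eqI)
  fix k
  show "Poly_Mapping.lookup p k = Poly_Mapping.lookup (lin_ext (\<lambda>k. Poly_Mapping.single k 1) p) k"
    by (simp add: lin_ext_def lookup_sum lookup_scaleC scaleC_complex_def lookup_single when_def
        if_distrib[where f = "\<lambda>x. _ * x"] in_keys_iff cong: if_cong)
qed

lemma clinear_poly_mapping_eqI:
  fixes f g :: "('k \<Rightarrow>\<^sub>0 complex) \<Rightarrow> 'v::complex_vector"
  assumes "clinear f" "clinear g" "\<And>k. f (Poly_Mapping.single k 1) = g (Poly_Mapping.single k 1)"
  shows "f p = g p"
proof -
  have "f p = lin_ext (\<lambda>k. f (Poly_Mapping.single k 1)) p"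
    using arg_cong[OF poly_mapping_decomp, of f p] by (simp add: lin_ext_def clinear_simps[OF assms(1)])
  moreover have "g p = lin_ext (\<lambda>k. g (Poly_Mapping.single k 1)) p"
    using arg_cong[OF poly_mapping_decomp, of g p] by (simp add: lin_ext_def clinear_simps[OF assms(2)])
  ultimately show ?thesis by (simp add: assms(3))
qed

section \<open>Tensor products\<close>

text \<open>\<open>V \<otimes> W\<close> is the free vector space on \<open>V \<times> W\<close> modulo the bilinearity relations.\<close>

definition tensor_relations :: "(('a::complex_vector \<times> 'b::complex_vector) \<Rightarrow>\<^sub>0 complex) set" where
  "tensor_relations =
     {Poly_Mapping.single (a + a', b) 1 - (Poly_Mapping.single (a, b) 1 + Poly_Mapping.single (a', b) 1) | a a' b. True} \<union>
     {Poly_Mapping.single (a, b + b') 1 - (Poly_Mapping.single (a, b) 1 + Poly_Mapping.single (a, b') 1) | a b b'. True} \<union>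
     {Poly_Mapping.single (c *\<^sub>C a, b) 1 - c *\<^sub>C Poly_Mapping.single (a, b) 1 | c a b. True} \<union>
     {Poly_Mapping.single (a, c *\<^sub>C b) 1 - c *\<^sub>C Poly_Mapping.single (a, b) 1 | c a b. True}"

quotient_type (overloaded) ('a, 'b) tensor =
  "('a::complex_vector \<times> 'b::complex_vector) \<Rightarrow>\<^sub>0 complex" /
  "\<lambda>p q. p - q \<in> cspan tensor_relations"
proof (rule equivpI)
  show "reflp (\<lambda>p q. p - q \<in> cspan (tensor_relations :: (('a \<times> 'b) \<Rightarrow>\<^sub>0 complex) set))"
    by (rule reflpI) (simp add: cvec.span_zero)
  show "symp (\<lambda>p q. p - q \<in> cspan (tensor_relations :: (('a \<times> 'b) \<Rightarrow>\<^sub>0 complex) set))"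
    by (rule sympI) (metis cvec.span_neg minus_diff_eq)
  show "transp (\<lambda>p q. p - q \<in> cspan (tensor_relations :: (('a \<times> 'b) \<Rightarrow>\<^sub>0 complex) set))"
  proof (rule transpI)
    fix p q r :: "('a \<times> 'b) \<Rightarrow>\<^sub>0 complex"
    assume "p - q \<in> cspan tensor_relations" "q - r \<in> cspan tensor_relations"
    then have "(p - q) + (q - r) \<in> cspan tensor_relations" by (rule cvec.span_add)
    then show "p - r \<in> cspan tensor_relations" by simp
  qed
qed

instantiation tensor :: (complex_vector, complex_vector) complex_vector
begin

lift_definition zero_tensor :: "('a, 'b) tensor" is 0 .

lift_definition plus_tensor :: "('a, 'b) tensor \<Rightarrow> ('a, 'b) tensor \<Rightarrow> ('a, 'b) tensor" is "(+)"
  subgoal premises prems for p q p' q'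
    using cvec.span_add[OF prems] by (simp add: algebra_simps)
  done

lift_definition uminus_tensor :: "('a, 'b) tensor \<Rightarrow> ('a, 'b) tensor" is uminus
  subgoal premises prems for p q
    using cvec.span_neg[OF prems] by simp
  done

lift_definition minus_tensor :: "('a, 'b) tensor \<Rightarrow> ('a, 'b) tensor \<Rightarrow> ('a, 'b) tensor" is "(-)"
  subgoal premises prems for p q p' q'
    using cvec.span_diff[OF prems] by (simp add: algebra_simps)
  done

lift_definition scaleC_tensor :: "complex \<Rightarrow> ('a, 'b) tensor \<Rightarrow> ('a, 'b) tensor" is scaleC
  subgoal premises prems for c p q
    using cvec.span_scale[OF prems, where c = c] by (simp add: cvec.scale_right_diff_distrib)
  done

instance
  by standard (transfer, simp add: cvec.span_zero scaleC_add_right scaleC_add_left scaleC_scaleC scaleC_one algebra_simps)+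

end

lift_definition tensor :: "'a::complex_vector \<Rightarrow> 'b::complex_vector \<Rightarrow> ('a, 'b) tensor"  (infixr \<open>\<otimes>\<close> 70)
  is "\<lambda>a b. Poly_Mapping.single (a, b) 1" .

lemma tensor_cbilinear: "cbilinear (\<otimes>)"
proof -
  have "p - q \<in> cspan tensor_relations" if "p - q \<in> tensor_relations"
    for p q :: "('a \<times> 'b) \<Rightarrow>\<^sub>0 complex"
    using that by (rule cvec.span_base)
  note * = this
  have "(a + a') \<otimes> b = a \<otimes> b + a' \<otimes> b" for a a' :: 'a and b :: 'b
    by (transfer, rule *, unfold tensor_relations_def, blast)
  moreover have "a \<otimes> (b + b') = a \<otimes> b + a \<otimes> b'" for a :: 'a and b b' :: 'b
    by (transfer, rule *, unfold tensor_relations_def, blast)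
  moreover have "(c *\<^sub>C a) \<otimes> b = c *\<^sub>C (a \<otimes> b)" "a \<otimes> (c *\<^sub>C b) = c *\<^sub>C (a \<otimes> b)"
    for a :: 'a and b :: 'b and c
    by (transfer, rule *, unfold tensor_relations_def, blast)+
  ultimately show ?thesis
    by (auto simp: cbilinear_def intro!: clinearI)
qed

lemmas
  tensor_add_left = clinear_add[OF spec[OF conjunct1[OF tensor_cbilinear[unfolded cbilinear_def]]]] and
  tensor_add_right = clinear_add[OF spec[OF conjunct2[OF tensor_cbilinear[unfolded cbilinear_def]]]] and
  tensor_scale_left = clinear_scale[OF spec[OF conjunct1[OF tensor_cbilinear[unfolded cbilinear_def]]]] and
  tensor_scale_right = clinear_scale[OF spec[OF conjunct2[OF tensor_cbilinear[unfolded cbilinear_def]]]]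

lemma tensor_clinear_left: "clinear (\<lambda>a. a \<otimes> b)" and tensor_clinear_right: "clinear (\<lambda>b. a \<otimes> b)"
  using tensor_cbilinear by (auto simp: cbilinear_def)

lemma tensor_induct [case_names pure add, induct type: tensor]:
  assumes pure: "\<And>a b. P (a \<otimes> b)" and add: "\<And>x y. P x \<Longrightarrow> P y \<Longrightarrow> P (x + y)"
  shows "P (x :: ('a::complex_vector, 'b::complex_vector) tensor)"
proof -
  define abs' where "abs' = (abs_tensor :: _ \<Rightarrow> ('a, 'b) tensor)"
  have abs: "clinear abs'" unfolding abs'_def
    by (rule clinearI) (simp_all add: plus_tensor.abs_eq scaleC_tensor.abs_eq)
  have single: "abs' (Poly_Mapping.single k 1) = fst k \<otimes> snd k" for k
    by (simp add: abs'_def tensor.abs_eq)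
  have P0: "P 0"
    using pure[of 0 0] by (metis tensor_scale_left cvec.scale_zero_left)
  have "P (abs' p)" for p
  proof -
    have "abs' p = (\<Sum>k\<in>Poly_Mapping.keys p. (Poly_Mapping.lookup p k *\<^sub>C fst k) \<otimes> snd k)"
      using arg_cong[OF poly_mapping_decomp, of abs' p] by
        (simp add: lin_ext_def clinear_simps[OF abs] single tensor_scale_left)
    moreover have "P (\<Sum>k\<in>S. (Poly_Mapping.lookup p k *\<^sub>C fst k) \<otimes> snd k)" for S
      by (induction S rule: infinite_finite_induct) (auto simp: P0 pure add)
    ultimately show ?thesis by simp
  qed
  from this[of "rep_tensor x"] show ?thesis
    by (simp add: abs'_def Quotient3_abs_rep[OF Quotient3_tensor])
qed

text \<open>The linear map \<open>V \<otimes> W \<rightarrow> U\<close> with \<open>a \<otimes> b \<mapsto> f a b\<close>, for bilinear \<open>f\<close>. For a tensor \<open>x = \<rho>(a)\<close>,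
  the term \<open>tensor_lift f x\<close> is what Sweedler notation writes as
  \<open>f a\<^bsub>-1\<^esub> a\<^bsub>0\<^esub>\<close>.\<close>

definition tensor_lift ::
  "('a \<Rightarrow> 'b \<Rightarrow> 'c) \<Rightarrow> ('a::complex_vector, 'b::complex_vector) tensor \<Rightarrow> 'c::complex_vector" where
  "tensor_lift f x = lin_ext (\<lambda>(a, b). f a b) (rep_tensor x)"

lemma
  fixes f :: "'a::complex_vector \<Rightarrow> 'b::complex_vector \<Rightarrow> 'c::complex_vector"
  assumes "cbilinear f"
  shows tensor_lift_tensor: "tensor_lift f (a \<otimes> b) = f a b"
    and tensor_lift_clinear: "clinear (tensor_lift f)"
proof -
  let ?F = "lin_ext (\<lambda>(a, b). f a b)"
  note lin = lin_ext_clinear[of "\<lambda>(a, b). f a b"]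
  have f1: "clinear (\<lambda>a. f a b)" and f2: "clinear (f a)" for a b
    using assms by (auto simp: cbilinear_def)
  have "?F r = 0" if "r \<in> cspan tensor_relations" for r
    using that
  proof (induction rule: cvec.span_induct)
    case base
    show ?case
      by (rule cvec.subspaceI) (simp_all add: clinear_simps[OF lin])
  next
    case (step r)
    then show ?case
      by (auto simp: tensor_relations_def clinear_simps[OF lin] scaleC_one
          clinear_simps[OF f1] clinear_simps[OF f2])
  qed
  then have eq: "?F p = ?F q" if "p - q \<in> cspan tensor_relations" for p q
    using that clinear_diff[OF lin, of p q] by simp
  have lift: "tensor_lift f (abs_tensor p) = ?F p" for p
    unfolding tensor_lift_def
    by (rule eq) (rule Quotient3_rep_abs[OF Quotient3_tensor], simp add: cvec.span_zero)
  show "tensor_lift f (a \<otimes> b) = f a b"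
    unfolding tensor.abs_eq lift by (simp add: scaleC_one)
  show "clinear (tensor_lift f)"
  proof (rule clinearI)
    fix x y :: "('a, 'b) tensor" and c
    obtain p q where "x = abs_tensor p" "y = abs_tensor q"
      by (metis Quotient3_abs_rep[OF Quotient3_tensor])
    then show "tensor_lift f (x + y) = tensor_lift f x + tensor_lift f y"
      "tensor_lift f (c *\<^sub>C x) = c *\<^sub>C tensor_lift f x"
      by (simp_all add: scaleC_tensor.abs_eq plus_tensor.abs_eq lift clinear_simps[OF lin])
  qed
qed

lemma tensor_lift_param:
  assumes "\<And>b b'. clinear (\<lambda>a. F a b b')"
  shows "clinear (\<lambda>a. tensor_lift (F a) x)"
proof -
  have "F (a + a') b b' = F a b b' + F a' b b'" "F (c *\<^sub>C a) b b' = c *\<^sub>C F a b b'" for a a' b b' c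
    by (rule clinear_simps[OF assms])+
  then show ?thesis
    unfolding tensor_lift_def lin_ext_def
    by (intro clinearI) (simp_all add: case_prod_beta scaleC_add_right sum.distrib
        cvec.scale_sum_right mult.commute)
qed

lemma cbilinearI: "(\<And>b. clinear (\<lambda>a. f a b)) \<Longrightarrow> (\<And>a. clinear (\<lambda>b. f a b)) \<Longrightarrow> cbilinear f"
  by (simp add: cbilinear_def)

lemma clinear_id: "clinear (\<lambda>x. x)"
  by (rule clinearI) simp_all

lemma clinear_scaleC: "clinear f \<Longrightarrow> clinear (\<lambda>x. c *\<^sub>C f x)"
  by (intro clinearI) (simp_all add: clinear_simps scaleC_add_right cvec.scale_left_commute)

lemma clinear_scaleC_left: "clinear f \<Longrightarrow> clinear (\<lambda>x. (f x :: complex) *\<^sub>C v)"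
  by (intro clinearI) (simp_all add: clinear_simps scaleC_add_left scaleC_complex_def scaleC_scaleC)

lemma clinear_plus: "clinear f \<Longrightarrow> clinear g \<Longrightarrow> clinear (\<lambda>x. f x + g x)"
  by (intro clinearI) (simp_all add: clinear_simps scaleC_add_right)

lemma clinear_minus': "clinear f \<Longrightarrow> clinear g \<Longrightarrow> clinear (\<lambda>x. f x - g x)"
  by (intro clinearI) (simp_all add: clinear_simps cvec.scale_right_diff_distrib)

lemma clinear_times_left: "clinear f \<Longrightarrow> clinear (\<lambda>x. f x * (b::'a::complex_comm_algebra))"
  by (intro clinearI) (simp_all add: clinear_simps distrib_right mult_scaleC_left)

lemma clinear_times_right: "clinear f \<Longrightarrow> clinear (\<lambda>x. (b::'a::complex_comm_algebra) * f x)"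
  by (intro clinearI) (simp_all add: clinear_simps distrib_left mult_scaleC_right)

lemma clinear_tensor_left: "clinear f \<Longrightarrow> clinear (\<lambda>x. f x \<otimes> b)"
  by (rule clinear_compose[OF tensor_clinear_left])

lemma clinear_tensor_right: "clinear f \<Longrightarrow> clinear (\<lambda>x. b \<otimes> f x)"
  by (rule clinear_compose[OF tensor_clinear_right])

lemma clinear_tensor_lift: "cbilinear F \<Longrightarrow> clinear g \<Longrightarrow> clinear (\<lambda>x. tensor_lift F (g x))"
  by (rule clinear_compose[OF tensor_lift_clinear])

lemma clinear_lin_ext: "clinear g \<Longrightarrow> clinear (\<lambda>x. lin_ext F (g x))"
  by (rule clinear_compose[OF lin_ext_clinear])

lemmas clinear_intros = clinear_id clinear_scaleC clinear_scaleC_left clinear_plus clinear_minus'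
  clinear_times_left clinear_times_right clinear_tensor_left clinear_tensor_right
  clinear_tensor_lift tensor_lift_param clinear_lin_ext cbilinearI

lemma clinear_tensor_eqI:
  assumes "clinear f" "clinear g" "\<And>a b. f (a \<otimes> b) = g (a \<otimes> b)"
  shows "f x = g x"
  by (induction x) (simp_all add: assms clinear_simps(1)[OF assms(1)] clinear_simps(1)[OF assms(2)])

text \<open>The tensor product of two commutative algebras, \<open>(a \<otimes> a') * (b \<otimes> b') = a b \<otimes> a' b'\<close>.\<close>

instantiation tensor :: (complex_comm_algebra, complex_comm_algebra) complex_comm_algebra
begin

definition one_tensor :: "('a, 'b) tensor" where "one_tensor = 1 \<otimes> 1"

definition times_tensor :: "('a, 'b) tensor \<Rightarrow> ('a, 'b) tensor \<Rightarrow> ('a, 'b) tensor" where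
  "times_tensor x y = tensor_lift (\<lambda>a a'. tensor_lift (\<lambda>b b'. (a * b) \<otimes> (a' * b')) y) x"

instance
proof -
  have pure: "(a \<otimes> a') * (b \<otimes> b') = (a * b) \<otimes> (a' * b')" for a b :: 'a and a' b' :: 'b
    unfolding times_tensor_def
    by (subst tensor_lift_tensor, (intro clinear_intros)[1])+ simp
  have L: "clinear (\<lambda>x. x * y)" and R: "clinear (\<lambda>x. y * x)" for y :: "('a, 'b) tensor"
    unfolding times_tensor_def by (intro clinear_intros)+
  note lin = clinear_simps[OF L] clinear_simps[OF R]
  show "OFCLASS(('a, 'b) tensor, complex_comm_algebra_class)"
  proof
    fix x y z :: "('a, 'b) tensor" and c
    have "(a \<otimes> a') * (b \<otimes> b') * z = (a \<otimes> a') * ((b \<otimes> b') * z)" for a a' b b'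
      by (induction z) (simp_all add: pure lin mult.assoc)
    then have "(a \<otimes> a') * y * z = (a \<otimes> a') * (y * z)" for a a'
      by (induction y) (simp_all add: lin)
    then show "x * y * z = x * (y * z)"
      by (induction x) (simp_all add: lin)
    have "(a \<otimes> a') * y = y * (a \<otimes> a')" for a a'
      by (induction y) (simp_all add: pure lin mult.commute)
    then show "x * y = y * x"
      by (induction x) (simp_all add: lin)
    show "(x + y) * z = x * z + y * z" "c *\<^sub>C x * y = c *\<^sub>C (x * y)"
      by (simp_all add: lin)
    show "1 * x = x"
      by (induction x) (simp_all add: pure lin one_tensor_def)
  qed
qed

end

lemma times_tensor_tensor: "(a \<otimes> a') * (b \<otimes> b') = (a * b) \<otimes> (a' * b')"
  for a b :: "'a::complex_comm_algebra" and a' b' :: "'b::complex_comm_algebra"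
  unfolding times_tensor_def
  by (subst tensor_lift_tensor, (intro clinear_intros)[1])+ simp

definition tensor_map ::
  "('a \<Rightarrow> 'c) \<Rightarrow> ('b \<Rightarrow> 'd) \<Rightarrow> ('a::complex_vector, 'b::complex_vector) tensor
    \<Rightarrow> ('c::complex_vector, 'd::complex_vector) tensor" where
  "tensor_map f g = tensor_lift (\<lambda>a b. f a \<otimes> g b)"

section \<open>Quotient spaces\<close>

text \<open>As the quotients \<open>V / W\<close> for varying subspaces \<open>W\<close> are not types, all of them
  are embedded in one vector space type, the direct sum \<open>\<Oplus>\<^sub>W V / W\<close>. The map
  \<open>qproj W\<close> is the quotient map from \<open>V\<close> onto the summand \<open>V / W\<close>; it is linear with
  kernel \<open>W\<close>.\<close>

quotient_type (overloaded) 'a quotients = "'a::complex_vector set \<Rightarrow>\<^sub>0 'a" /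
  "\<lambda>p q. \<forall>W. Poly_Mapping.lookup p W - Poly_Mapping.lookup q W \<in> cspan W"
proof (rule equivpI)
  show "reflp (\<lambda>p q. \<forall>W. Poly_Mapping.lookup p W - Poly_Mapping.lookup q W \<in> cspan (W::'a set))"
    by (rule reflpI) (simp add: cvec.span_zero)
  show "symp (\<lambda>p q. \<forall>W. Poly_Mapping.lookup p W - Poly_Mapping.lookup q W \<in> cspan (W::'a set))"
    by (rule sympI) (metis cvec.span_neg minus_diff_eq)
  show "transp (\<lambda>p q. \<forall>W. Poly_Mapping.lookup p W - Poly_Mapping.lookup q W \<in> cspan (W::'a set))"
  proof (intro transpI allI)
    fix p q r :: "'a set \<Rightarrow>\<^sub>0 'a" and W :: "'a set"
    assume "\<forall>W. Poly_Mapping.lookup p W - Poly_Mapping.lookup q W \<in> cspan W"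
      "\<forall>W. Poly_Mapping.lookup q W - Poly_Mapping.lookup r W \<in> cspan W"
    then have "(Poly_Mapping.lookup p W - Poly_Mapping.lookup q W) +
        (Poly_Mapping.lookup q W - Poly_Mapping.lookup r W) \<in> cspan W"
      by (blast intro: cvec.span_add)
    then show "Poly_Mapping.lookup p W - Poly_Mapping.lookup r W \<in> cspan W" by simp
  qed
qed

instantiation quotients :: (complex_vector) complex_vector
begin

lift_definition zero_quotients :: "'a quotients" is 0 .

lift_definition plus_quotients :: "'a quotients \<Rightarrow> 'a quotients \<Rightarrow> 'a quotients" is "(+)"
  subgoal premises prems for p q p' q'
    using cvec.span_add[OF prems] by (simp add: algebra_simps lookup_add)
  done

lift_definition uminus_quotients :: "'a quotients \<Rightarrow> 'a quotients" is uminus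
  subgoal premises prems for p q
    using cvec.span_neg[OF prems] by simp
  done

lift_definition minus_quotients :: "'a quotients \<Rightarrow> 'a quotients \<Rightarrow> 'a quotients" is "(-)"
  subgoal premises prems for p q p' q'
    using cvec.span_diff[OF prems] by (simp add: algebra_simps lookup_minus)
  done

lift_definition scaleC_quotients :: "complex \<Rightarrow> 'a quotients \<Rightarrow> 'a quotients" is scaleC
  subgoal premises prems for c p q
    using cvec.span_scale[OF prems, where c = c]
    by (simp add: cvec.scale_right_diff_distrib lookup_scaleC)
  done

instance
  by standard (transfer, simp add: cvec.span_zero scaleC_add_right scaleC_add_left scaleC_scaleC scaleC_one algebra_simps)+

end

lift_definition qproj :: "'a::complex_vector set \<Rightarrow> 'a \<Rightarrow> 'a quotients"
  is "\<lambda>W x. Poly_Mapping.single W x" .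

lemma qproj_clinear: "clinear (qproj W)"
  by (rule clinearI; transfer) (simp_all add: single_add scaleC_single cvec.span_zero)

lemma qproj_eq_0_iff: "qproj W x = 0 \<longleftrightarrow> x \<in> cspan W"
  by transfer (auto simp: lookup_single when_def cvec.span_zero)

lemma qproj_eq_iff: "qproj W x = qproj W y \<longleftrightarrow> x - y \<in> cspan W"
  using qproj_eq_0_iff[of W "x - y"] by (simp add: clinear_diff[OF qproj_clinear])

text \<open>The linear map induced on \<open>V / W\<close> by a linear map \<open>f\<close> on \<open>V\<close> with \<open>f(W) = 0\<close>; it is
  extended by zero to the other summands.\<close>

definition qlift :: "'a set \<Rightarrow> ('a \<Rightarrow> 'b) \<Rightarrow> 'a::complex_vector quotients \<Rightarrow> 'b::complex_vector" where
  "qlift W f q = f (Poly_Mapping.lookup (rep_quotients q) W)"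

lemma
  fixes f :: "'a::complex_vector \<Rightarrow> 'b::complex_vector"
  assumes "clinear f" "\<And>w. w \<in> W \<Longrightarrow> f w = 0"
  shows qlift_qproj: "qlift W f (qproj W x) = f x"
    and qlift_clinear: "clinear (qlift W f)"
proof -
  have ker: "f w = 0" if "w \<in> cspan W" for w
    using that
  proof (induction rule: cvec.span_induct)
    case base
    show ?case
      by (rule cvec.subspaceI) (simp_all add: clinear_simps[OF assms(1)])
  qed (rule assms(2))
  have lift: "qlift W f (abs_quotients p) = f (Poly_Mapping.lookup p W)" for p
  proof -
    have "\<forall>W. Poly_Mapping.lookup (rep_quotients (abs_quotients p)) W - Poly_Mapping.lookup p W \<in> cspan W"
      by (rule Quotient3_rep_abs[OF Quotient3_quotients]) (simp add: cvec.span_zero)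
    from ker[OF this[THEN spec]] show ?thesis
      by (simp add: qlift_def clinear_diff[OF assms(1)])
  qed
  show "qlift W f (qproj W x) = f x"
    by (simp add: qproj.abs_eq lift)
  show "clinear (qlift W f)"
  proof (rule clinearI)
    fix x y :: "'a quotients" and c
    obtain p q where "x = abs_quotients p" "y = abs_quotients q"
      by (metis Quotient3_abs_rep[OF Quotient3_quotients])
    then show "qlift W f (x + y) = qlift W f x + qlift W f y"
      "qlift W f (c *\<^sub>C x) = c *\<^sub>C qlift W f x"
      by (simp_all add: scaleC_quotients.abs_eq plus_quotients.abs_eq lift lookup_add lookup_scaleC
          clinear_simps[OF assms(1)])
  qed
qed


section \<open>The coordinate algebra of the 3-sphere\<close>

text \<open>The free commutative \<open>*\<close>-algebra on \<open>z\<^sub>1, z\<^sub>2\<close> is the polynomial algebra in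
  \<open>z\<^sub>1, z\<^sub>2, z\<^sub>1\<^sup>*, z\<^sub>2\<^sup>*\<close>.\<close>

datatype gen = Z1 | Z2 | Z1s | Z2s

lemma UNIV_gen: "UNIV = {Z1, Z2, Z1s, Z2s}"
  by (auto intro: gen.exhaust)

fun gen_star :: "gen \<Rightarrow> gen" where
  "gen_star Z1 = Z1s" | "gen_star Z2 = Z2s" | "gen_star Z1s = Z1" | "gen_star Z2s = Z2"

lemma inj_gen_star: "inj gen_star"
proof (rule injI)
  fix v w assume "gen_star v = gen_star w"
  then show "v = w" by (cases v; cases w) simp_all
qed

type_synonym free_poly = "(gen \<Rightarrow>\<^sub>0 nat) \<Rightarrow>\<^sub>0 complex"

definition pvar :: "gen \<Rightarrow> free_poly" where
  "pvar v = Poly_Mapping.single (Poly_Mapping.single v 1) 1"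

definition poly_star :: "free_poly \<Rightarrow> free_poly" where
  "poly_star p = (\<Sum>m\<in>Poly_Mapping.keys p.
     Poly_Mapping.single (Poly_Mapping.map_key gen_star m) (cnj (Poly_Mapping.lookup p m)))"

definition star_ideal :: "free_poly set \<Rightarrow> bool" where
  "star_ideal I \<longleftrightarrow> 0 \<in> I \<and> (\<forall>p\<in>I. \<forall>q\<in>I. p + q \<in> I) \<and> (\<forall>p\<in>I. \<forall>q. q * p \<in> I) \<and>
     (\<forall>p\<in>I. poly_star p \<in> I)"

definition sphere_relation :: free_poly where
  "sphere_relation = pvar Z1s * pvar Z1 + pvar Z2s * pvar Z2 - 1"

definition sphere_ideal :: "free_poly set" where
  "sphere_ideal = \<Inter>{I. star_ideal I \<and> sphere_relation \<in> I}"

lemma star_ideal_sphere_ideal: "star_ideal sphere_ideal"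
  unfolding sphere_ideal_def star_ideal_def by auto

lemma
  shows sphere_ideal_0: "0 \<in> sphere_ideal"
    and sphere_ideal_add: "p \<in> sphere_ideal \<Longrightarrow> q \<in> sphere_ideal \<Longrightarrow> p + q \<in> sphere_ideal"
    and sphere_ideal_mult: "p \<in> sphere_ideal \<Longrightarrow> r * p \<in> sphere_ideal"
    and sphere_ideal_star: "p \<in> sphere_ideal \<Longrightarrow> poly_star p \<in> sphere_ideal"
    and sphere_ideal_relation: "sphere_relation \<in> sphere_ideal"
  using star_ideal_sphere_ideal unfolding star_ideal_def by (auto simp: sphere_ideal_def)

lemma sphere_ideal_minus: "p \<in> sphere_ideal \<Longrightarrow> - p \<in> sphere_ideal"
  using sphere_ideal_mult[of p "-1"] by simp

lemma sphere_ideal_scaleC: "p \<in> sphere_ideal \<Longrightarrow> c *\<^sub>C p \<in> sphere_ideal"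
  by (simp add: scaleC_eq_single_mult sphere_ideal_mult)

lemma poly_star_superset:
  "finite S \<Longrightarrow> Poly_Mapping.keys p \<subseteq> S \<Longrightarrow> poly_star p = (\<Sum>m\<in>S.
     Poly_Mapping.single (Poly_Mapping.map_key gen_star m) (cnj (Poly_Mapping.lookup p m)))"
  unfolding poly_star_def by (rule sum.mono_neutral_left) (auto simp: in_keys_iff)

lemma poly_star_add: "poly_star (p + q) = poly_star p + poly_star q"
proof -
  let ?S = "Poly_Mapping.keys p \<union> Poly_Mapping.keys q"
  have "finite ?S" by simp
  then show ?thesis
    using keys_add[of p q]
    by (simp add: poly_star_superset[of ?S] lookup_add single_add sum.distrib)
qed

lemma poly_star_single [simp]:
  "poly_star (Poly_Mapping.single m c) = Poly_Mapping.single (Poly_Mapping.map_key gen_star m) (cnj c)"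
  by (cases "c = 0") (simp_all add: poly_star_def)

lemma poly_star_0 [simp]: "poly_star 0 = 0"
  by (simp add: poly_star_def)

lemma poly_star_uminus: "poly_star (- p) = - poly_star p"
  using poly_star_add[of p "- p"] by (simp add: add_eq_0_iff)

lemma poly_star_diff: "poly_star (p - q) = poly_star p - poly_star q"
  using poly_star_add[of p "- q"] by (simp add: poly_star_uminus)

lemma poly_star_1: "poly_star 1 = 1"
proof -
  show ?thesis
    unfolding single_one[symmetric] poly_star_single by (simp add: inj_gen_star)
qed

quotient_type sphere = free_poly / "\<lambda>p q. p - q \<in> sphere_ideal"
proof (rule equivpI)
  show "reflp (\<lambda>p q. p - q \<in> sphere_ideal)"
    by (rule reflpI) (simp add: sphere_ideal_0)
  show "symp (\<lambda>p q. p - q \<in> sphere_ideal)"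
    by (rule sympI) (metis sphere_ideal_minus minus_diff_eq)
  show "transp (\<lambda>p q. p - q \<in> sphere_ideal)"
  proof (rule transpI)
    fix p q r
    assume "p - q \<in> sphere_ideal" "q - r \<in> sphere_ideal"
    then have "(p - q) + (q - r) \<in> sphere_ideal" by (rule sphere_ideal_add)
    then show "p - r \<in> sphere_ideal" by simp
  qed
qed

instantiation sphere :: complex_comm_algebra
begin

lift_definition zero_sphere :: sphere is 0 .
lift_definition one_sphere :: sphere is 1 .

lift_definition plus_sphere :: "sphere \<Rightarrow> sphere \<Rightarrow> sphere" is "(+)"
  subgoal premises prems for p q p' q'
    using sphere_ideal_add[OF prems] by (simp add: algebra_simps)
  done

lift_definition uminus_sphere :: "sphere \<Rightarrow> sphere" is uminus
  subgoal premises prems for p q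
    using sphere_ideal_minus[OF prems] by simp
  done

lift_definition minus_sphere :: "sphere \<Rightarrow> sphere \<Rightarrow> sphere" is "(-)"
  subgoal premises prems for p q p' q'
    using sphere_ideal_add[OF prems(1) sphere_ideal_minus[OF prems(2)]] by (simp add: algebra_simps)
  done

lift_definition scaleC_sphere :: "complex \<Rightarrow> sphere \<Rightarrow> sphere" is scaleC
  subgoal premises prems for c p q
    using sphere_ideal_scaleC[OF prems, of c] by (simp add: cvec.scale_right_diff_distrib)
  done

lift_definition times_sphere :: "sphere \<Rightarrow> sphere \<Rightarrow> sphere" is "(*)"
  subgoal premises prems for p q p' q'
    using sphere_ideal_add[OF sphere_ideal_mult[OF prems(1), of p'] sphere_ideal_mult[OF prems(2), of q]]
    by (simp add: right_diff_distrib mult.commute)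
  done

instance
proof
  fix a b c :: sphere and x y :: complex
  show "a + b + c = a + (b + c)" "a + b = b + a" "0 + a = a" "- a + a = 0" "a - b = a + - b"
    by (transfer, simp add: sphere_ideal_0)+
  show "x *\<^sub>C (a + b) = x *\<^sub>C a + x *\<^sub>C b" "(x + y) *\<^sub>C a = x *\<^sub>C a + y *\<^sub>C a"
    "x *\<^sub>C y *\<^sub>C a = (x * y) *\<^sub>C a" "1 *\<^sub>C a = a"
    by (transfer, simp add: sphere_ideal_0 scaleC_add_right scaleC_add_left)+
  show "a * b * c = a * (b * c)" "(a + b) * c = a * c + b * c" "x *\<^sub>C a * b = x *\<^sub>C (a * b)"
    "1 * a = a"
    by (transfer, simp add: sphere_ideal_0 mult_scaleC_left mult.assoc distrib_right)+
  show "a * b = b * a"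
    by transfer (simp add: sphere_ideal_0 mult.commute)
qed

end

lift_definition sphere_star :: "sphere \<Rightarrow> sphere" is poly_star
  subgoal premises prems for p q
    using sphere_ideal_star[OF prems] by (simp add: poly_star_diff)
  done

lift_definition gen_elt :: "gen \<Rightarrow> sphere" is pvar .

abbreviation "z\<^sub>1 \<equiv> gen_elt Z1"
abbreviation "z\<^sub>2 \<equiv> gen_elt Z2"

lemma map_key_gen_star_single:
  "Poly_Mapping.map_key gen_star (Poly_Mapping.single v n) = Poly_Mapping.single (gen_star v) n"
proof -
  have "gen_star (gen_star v) = v" by (cases v) auto
  with map_key_single[OF inj_gen_star, of "gen_star v" n] show ?thesis by simp
qed

lemma sphere_star_gen: "sphere_star (gen_elt v) = gen_elt (gen_star v)"
  by transfer (simp add: pvar_def map_key_gen_star_single sphere_ideal_0)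

lemma sphere_eq: "sphere_star z\<^sub>1 * z\<^sub>1 + sphere_star z\<^sub>2 * z\<^sub>2 = 1"
  unfolding sphere_star_gen gen_star.simps
  by transfer (use sphere_ideal_relation in \<open>simp add: sphere_relation_def\<close>)

text \<open>The unital algebra map on \<open>\<O>(S\<^sup>3)\<close> with \<open>v \<mapsto> g v\<close> for the four generators \<open>v\<close>, for \<open>g\<close>
  respecting the sphere relation.\<close>

definition poly_ext :: "(gen \<Rightarrow> 'b::complex_comm_algebra) \<Rightarrow> free_poly \<Rightarrow> 'b" where
  "poly_ext g = lin_ext (\<lambda>m. \<Prod>v\<in>UNIV. g v ^ Poly_Mapping.lookup m v)"

definition sphere_ext :: "(gen \<Rightarrow> 'b::complex_comm_algebra) \<Rightarrow> sphere \<Rightarrow> 'b" where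
  "sphere_ext g a = poly_ext g (rep_sphere a)"

lemma poly_ext_clinear: "clinear (poly_ext g)"
  unfolding poly_ext_def by (rule lin_ext_clinear)

lemma poly_ext_mult: "poly_ext g (p * q) = poly_ext g p * poly_ext g q"
proof (rule clinear_poly_mapping_eqI[where p = p])
  note lin = poly_ext_clinear[THEN clinear_compose]
  show "clinear (\<lambda>p. poly_ext g (p * q))" "clinear (\<lambda>p. poly_ext g p * poly_ext g q)"
    by (intro lin clinear_intros)+
  fix m
  show "poly_ext g (Poly_Mapping.single m 1 * q) = poly_ext g (Poly_Mapping.single m 1) * poly_ext g q"
  proof (rule clinear_poly_mapping_eqI[where p = q])
    show "clinear (\<lambda>q. poly_ext g (Poly_Mapping.single m 1 * q))"
      "clinear (\<lambda>q. poly_ext g (Poly_Mapping.single m 1) * poly_ext g q)"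
      by (intro lin clinear_intros)+
    fix n
    show "poly_ext g (Poly_Mapping.single m 1 * Poly_Mapping.single n 1) =
        poly_ext g (Poly_Mapping.single m 1) * poly_ext g (Poly_Mapping.single n 1)"
      by (simp add: mult_single poly_ext_def lookup_add power_add prod.distrib scaleC_one)
  qed
qed

lemma poly_ext_1: "poly_ext g 1 = 1"
proof -
  have "poly_ext g (Poly_Mapping.single 0 1) = 1"
    unfolding poly_ext_def lin_ext_single by (simp add: scaleC_one)
  then show ?thesis by simp
qed

lemma poly_ext_pvar: "poly_ext g (pvar v) = g v"
proof -
  have "(\<Prod>w\<in>UNIV. g w ^ Poly_Mapping.lookup (Poly_Mapping.single v 1) w) = g v"
    unfolding UNIV_gen by (cases v) (simp_all add: lookup_single)
  then show ?thesis
    by (simp add: poly_ext_def pvar_def scaleC_one)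
qed

lemma poly_star_mult: "poly_star (p * q) = poly_star p * poly_star q"
proof -
  have sum: "P r" if "P 0" "\<And>x y. P x \<Longrightarrow> P y \<Longrightarrow> P (x + y)" "\<And>m c. P (Poly_Mapping.single m c)"
    for P and r :: free_poly
  proof -
    have "P (\<Sum>m\<in>S. Poly_Mapping.single m (Poly_Mapping.lookup r m))" for S
      by (induction S rule: infinite_finite_induct) (auto simp: that)
    moreover have "r = (\<Sum>m\<in>Poly_Mapping.keys r. Poly_Mapping.single m (Poly_Mapping.lookup r m))"
      using poly_mapping_decomp[of r] by (simp add: lin_ext_def scaleC_single scaleC_complex_def)
    ultimately show ?thesis by metis
  qed
  have "poly_star (Poly_Mapping.single m c * q) = poly_star (Poly_Mapping.single m c) * poly_star q" for m c
    by (rule sum[where P = "\<lambda>q. poly_star (Poly_Mapping.single m c * q) =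
        poly_star (Poly_Mapping.single m c) * poly_star q" and r = q])
      (simp_all add: poly_star_add distrib_left mult_single map_key_plus[OF inj_gen_star])
  then show ?thesis
    by (intro sum[where P = "\<lambda>p. poly_star (p * q) = poly_star p * poly_star q" and r = p])
      (simp_all add: poly_star_add distrib_right)
qed

lemma sphere_ideal_eq: "sphere_ideal = {p * sphere_relation | p. True}"
proof
  have "poly_star (pvar v) = pvar (gen_star v)" for v
    by (simp add: pvar_def map_key_gen_star_single)
  then have rel: "poly_star sphere_relation = sphere_relation"
    by (simp add: sphere_relation_def poly_star_add poly_star_diff poly_star_mult poly_star_1 mult.commute)
  have "star_ideal {p * sphere_relation | p. True}" (is "star_ideal ?I")
    unfolding star_ideal_def
  proof (intro conjI ballI allI)
    have in_I: "p * sphere_relation \<in> ?I" for p by blast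
    show "0 \<in> ?I" using in_I[of 0] by simp
    fix p assume "p \<in> ?I"
    then obtain p' where p: "p = p' * sphere_relation" by blast
    show "poly_star p \<in> ?I"
      using in_I[of "poly_star p'"] by (simp only: p poly_star_mult rel)
    show "q * p \<in> ?I" for q
      using in_I[of "q * p'"] by (simp only: p mult.assoc)
    fix q assume "q \<in> ?I"
    then obtain q' where q: "q = q' * sphere_relation" by blast
    show "p + q \<in> ?I"
      using in_I[of "p' + q'"] by (simp only: p q distrib_right)
  qed
  moreover have "sphere_relation \<in> {p * sphere_relation | p. True}"
    by (rule CollectI, rule exI[of _ 1]) simp
  ultimately show "sphere_ideal \<subseteq> {p * sphere_relation | p. True}"
    unfolding sphere_ideal_def by blast
qed (auto intro: sphere_ideal_mult sphere_ideal_relation)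

lemma
  assumes "g Z1s * g Z1 + g Z2s * g Z2 = 1"
  shows sphere_ext_clinear: "clinear (sphere_ext g)"
    and sphere_ext_mult: "sphere_ext g (a * b) = sphere_ext g a * sphere_ext g b"
    and sphere_ext_1: "sphere_ext g 1 = 1"
    and sphere_ext_gen: "sphere_ext g (gen_elt v) = g v"
proof -
  have "poly_ext g sphere_relation = 0"
    by (simp add: sphere_relation_def clinear_simps[OF poly_ext_clinear] poly_ext_mult poly_ext_pvar
        poly_ext_1 assms)
  then have "poly_ext g p = 0" if "p \<in> sphere_ideal" for p
    using that by (auto simp: sphere_ideal_eq poly_ext_mult)
  then have "poly_ext g p = poly_ext g q" if "p - q \<in> sphere_ideal" for p q
    using that clinear_diff[OF poly_ext_clinear, of g p q] by simp
  then have lift: "sphere_ext g (abs_sphere p) = poly_ext g p" for p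
    unfolding sphere_ext_def
    using Quotient3_rep_abs[OF Quotient3_sphere, of p] by (simp add: sphere_ideal_0)
  have ex: "\<exists>p. a = abs_sphere p" for a
    by (metis Quotient3_abs_rep[OF Quotient3_sphere])
  show "clinear (sphere_ext g)"
  proof (rule clinearI)
    fix x y c
    show "sphere_ext g (x + y) = sphere_ext g x + sphere_ext g y"
      "sphere_ext g (c *\<^sub>C x) = c *\<^sub>C sphere_ext g x"
      using ex[of x] ex[of y]
      by (auto simp: plus_sphere.abs_eq scaleC_sphere.abs_eq lift clinear_simps[OF poly_ext_clinear])
  qed
  show "sphere_ext g (a * b) = sphere_ext g a * sphere_ext g b"
    using ex[of a] ex[of b] by (auto simp: times_sphere.abs_eq lift poly_ext_mult)
  show "sphere_ext g 1 = 1"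
    by (simp add: one_sphere.abs_eq lift poly_ext_1)
  show "sphere_ext g (gen_elt v) = g v"
    by (simp add: gen_elt.abs_eq lift poly_ext_pvar)
qed

section \<open>The structure Hopf algebra, the torus and their coactions\<close>

text \<open>\<open>H = \<O>(U(1))\<close> and \<open>K = \<O>(T\<^sup>2)\<close> are group algebras; the product of
  \<^theory>\<open>HOL-Library.Poly_Mapping\<close> is the convolution product. Only the parts of the Hopf algebra
  structure which are used below are given.\<close>

type_synonym H = "int \<Rightarrow>\<^sub>0 complex"
type_synonym K = "int \<times> int \<Rightarrow>\<^sub>0 complex"

definition tH :: "int \<Rightarrow> H" where "tH n = Poly_Mapping.single n 1"
definition tK :: "int \<times> int \<Rightarrow> K" where "tK m = Poly_Mapping.single m 1"

fun delta_gen :: "gen \<Rightarrow> (sphere, H) tensor" where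
  "delta_gen Z1 = gen_elt Z1 \<otimes> tH 1"
| "delta_gen Z2 = gen_elt Z2 \<otimes> tH 1"
| "delta_gen Z1s = gen_elt Z1s \<otimes> tH (-1)"
| "delta_gen Z2s = gen_elt Z2s \<otimes> tH (-1)"

fun rho_gen :: "gen \<Rightarrow> (K, sphere) tensor" where
  "rho_gen Z1 = tK (1, 0) \<otimes> gen_elt Z1"
| "rho_gen Z2 = tK (0, 1) \<otimes> gen_elt Z2"
| "rho_gen Z1s = tK (-1, 0) \<otimes> gen_elt Z1s"
| "rho_gen Z2s = tK (0, -1) \<otimes> gen_elt Z2s"

definition delta :: "sphere \<Rightarrow> (sphere, H) tensor" where "delta = sphere_ext delta_gen"
definition rho :: "sphere \<Rightarrow> (K, sphere) tensor" where "rho = sphere_ext rho_gen"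

lemma tH_mult: "tH m * tH n = tH (m + n)" and tH_0: "tH 0 = 1"
  and tK_mult: "tK k * tK l = tK (k + l)" and tK_0: "tK 0 = 1"
  by (simp_all add: tH_def tK_def mult_single)

lemma gen_elt_eq: "gen_elt Z1s * gen_elt Z1 + gen_elt Z2s * gen_elt Z2 = 1"
  using sphere_eq by (simp add: sphere_star_gen)

lemma delta_gen_eq: "delta_gen Z1s * delta_gen Z1 + delta_gen Z2s * delta_gen Z2 = 1"
  by (simp add: times_tensor_tensor tH_mult tH_0 one_tensor_def)
    (simp only: gen_elt_eq flip: tensor_add_left)

lemma rho_gen_eq: "rho_gen Z1s * rho_gen Z1 + rho_gen Z2s * rho_gen Z2 = 1"
  by (simp add: times_tensor_tensor tK_mult tK_0[unfolded zero_prod_def] one_tensor_def)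
    (simp only: gen_elt_eq flip: tensor_add_right)

lemmas delta_clinear = sphere_ext_clinear[of delta_gen, OF delta_gen_eq, folded delta_def]
  and delta_mult = sphere_ext_mult[of delta_gen, OF delta_gen_eq, folded delta_def]
  and delta_1 = sphere_ext_1[of delta_gen, OF delta_gen_eq, folded delta_def]
  and delta_gen_elt = sphere_ext_gen[of delta_gen, OF delta_gen_eq, folded delta_def]

lemmas rho_clinear = sphere_ext_clinear[of rho_gen, OF rho_gen_eq, folded rho_def]
  and rho_mult = sphere_ext_mult[of rho_gen, OF rho_gen_eq, folded rho_def]
  and rho_1 = sphere_ext_1[of rho_gen, OF rho_gen_eq, folded rho_def]
  and rho_gen_elt = sphere_ext_gen[of rho_gen, OF rho_gen_eq, folded rho_def]

definition counit_H :: "H \<Rightarrow> complex" where "counit_H = lin_ext (\<lambda>n. 1)"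
definition X_H :: "H \<Rightarrow> complex" where "X_H = lin_ext (\<lambda>n. of_int n)"

lemma X_H_clinear: "clinear X_H" and X_H_tH: "X_H (tH n) = of_int n"
  and counit_H_clinear: "clinear counit_H" and counit_H_tH: "counit_H (tH n) = 1"
  by (simp_all add: X_H_def counit_H_def lin_ext_clinear tH_def scaleC_one)

lemma X_H_derivation: "X_H (h * h') = X_H h * counit_H h' + counit_H h * X_H h'"
proof (rule clinear_poly_mapping_eqI[where p = h])
  note lin = X_H_clinear[THEN clinear_compose] counit_H_clinear[THEN clinear_compose]
  show "clinear (\<lambda>h. X_H (h * h'))" "clinear (\<lambda>h. X_H h * counit_H h' + counit_H h * X_H h')"
    by (intro lin clinear_intros)+
  fix m
  show "X_H (Poly_Mapping.single m 1 * h') =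
      X_H (Poly_Mapping.single m 1) * counit_H h' + counit_H (Poly_Mapping.single m 1) * X_H h'"
  proof (rule clinear_poly_mapping_eqI[where p = h'])
    show "clinear (\<lambda>h'. X_H (Poly_Mapping.single m 1 * h'))"
      "clinear (\<lambda>h'. X_H (Poly_Mapping.single m 1) * counit_H h' + counit_H (Poly_Mapping.single m 1) * X_H h')"
      by (intro lin clinear_intros)+
  qed (simp add: X_H_tH counit_H_tH tH_mult flip: tH_def)
qed

section \<open>The deformed algebra\<close>

definition sigma_coeff :: "real \<Rightarrow> int \<times> int \<Rightarrow> int \<times> int \<Rightarrow> complex" where
  "sigma_coeff \<theta> m n =
     exp (complex_of_real pi * \<i> * complex_of_real \<theta> * of_int (fst m * snd n - snd m * fst n))"

definition R_coeff :: "real \<Rightarrow> int \<times> int \<Rightarrow> int \<times> int \<Rightarrow> complex" where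
  "R_coeff \<theta> m n =
     exp (- 2 * complex_of_real pi * \<i> * complex_of_real \<theta> * of_int (fst m * snd n - snd m * fst n))"

definition K_form :: "(int \<times> int \<Rightarrow> int \<times> int \<Rightarrow> complex) \<Rightarrow> (K, K) tensor \<Rightarrow> complex" where
  "K_form c = tensor_lift (\<lambda>k l. lin_ext (\<lambda>m. lin_ext (c m) l) k)"

definition sigma :: "real \<Rightarrow> (K, K) tensor \<Rightarrow> complex" where "sigma \<theta> = K_form (sigma_coeff \<theta>)"
definition R_mat :: "real \<Rightarrow> (K, K) tensor \<Rightarrow> complex" where "R_mat \<theta> = K_form (R_coeff \<theta>)"

text \<open>The product \<open>\<star>\<^sub>\<theta>\<close> of \<open>A\<^sub>\<theta>\<close> on the vector space \<open>A\<close>, and the braided tensor product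
  algebra structure on \<open>A\<^sub>\<theta> \<otimes> A\<^sub>\<theta>\<close>.\<close>

definition star_prod :: "real \<Rightarrow> sphere \<Rightarrow> sphere \<Rightarrow> sphere" where
  "star_prod \<theta> a a' =
     tensor_lift (\<lambda>k a0. tensor_lift (\<lambda>k' a0'. sigma \<theta> (k \<otimes> k') *\<^sub>C (a0 * a0')) (rho a')) (rho a)"

definition braided_prod ::
  "real \<Rightarrow> (sphere, sphere) tensor \<Rightarrow> (sphere, sphere) tensor \<Rightarrow> (sphere, sphere) tensor" where
  "braided_prod \<theta> x y =
     tensor_lift (\<lambda>a a'. tensor_lift (\<lambda>b b'.
       tensor_lift (\<lambda>k b0. tensor_lift (\<lambda>k' a0'.
         R_mat \<theta> (k \<otimes> k') *\<^sub>C (star_prod \<theta> a b0 \<otimes> star_prod \<theta> a0' b')) (rho a')) (rho b)) y) x"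

section \<open>Kaehler forms\<close>

text \<open>Throughout, \<open>m\<close> is the product of a unital algebra structure on the vector space \<open>'a\<close> with
  unit \<open>1\<close>, and \<open>p\<close> is the product of an algebra structure on \<open>'a \<otimes> 'a\<close>. Forms are
  represented in \<open>\<Oplus>\<^sub>W ('a \<otimes> 'a) / W\<close>, in the summand \<open>W = (ker \<mu>)\<^sup>2\<close>.\<close>

definition mu_ker :: "('a \<Rightarrow> 'a \<Rightarrow> 'a) \<Rightarrow> ('a::complex_vector, 'a) tensor set" where
  "mu_ker m = {x. tensor_lift m x = 0}"

definition mu_ker_sq ::
  "('a \<Rightarrow> 'a \<Rightarrow> 'a) \<Rightarrow> (('a, 'a) tensor \<Rightarrow> ('a, 'a) tensor \<Rightarrow> ('a, 'a) tensor)
    \<Rightarrow> ('a::complex_vector, 'a) tensor set" where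
  "mu_ker_sq m p = cspan {p x y | x y. x \<in> mu_ker m \<and> y \<in> mu_ker m}"

definition kaehler ::
  "('a \<Rightarrow> 'a \<Rightarrow> 'a) \<Rightarrow> (('a, 'a) tensor \<Rightarrow> ('a, 'a) tensor \<Rightarrow> ('a, 'a) tensor)
    \<Rightarrow> ('a::complex_vector, 'a) tensor quotients set" where
  "kaehler m p = qproj (mu_ker_sq m p) ` mu_ker m"

definition kaehler_d ::
  "('a \<Rightarrow> 'a \<Rightarrow> 'a) \<Rightarrow> (('a, 'a) tensor \<Rightarrow> ('a, 'a) tensor \<Rightarrow> ('a, 'a) tensor)
    \<Rightarrow> 'a \<Rightarrow> ('a::{complex_vector, one}, 'a) tensor quotients" where
  "kaehler_d m p a = qproj (mu_ker_sq m p) (1 \<otimes> a - a \<otimes> 1)"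

text \<open>The left action, induced by \<open>a \<cdot> (b \<otimes> b') = a b \<otimes> b'\<close>.\<close>

definition kaehler_act ::
  "('a \<Rightarrow> 'a \<Rightarrow> 'a) \<Rightarrow> (('a, 'a) tensor \<Rightarrow> ('a, 'a) tensor \<Rightarrow> ('a, 'a) tensor)
    \<Rightarrow> 'a \<Rightarrow> ('a::complex_vector, 'a) tensor quotients \<Rightarrow> ('a, 'a) tensor quotients" where
  "kaehler_act m p a = qlift (mu_ker_sq m p)
     (\<lambda>x. qproj (mu_ker_sq m p) (tensor_lift (\<lambda>b b'. m a b \<otimes> b') x))"

text \<open>The tensor product coactions on \<open>A \<otimes> A\<close>, and the coactions induced on its quotient by a
  subspace \<open>W\<close>.\<close>

type_synonym form = "(sphere, sphere) tensor quotients"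

definition rho_tensor :: "(sphere, sphere) tensor \<Rightarrow> (K, (sphere, sphere) tensor) tensor" where
  "rho_tensor = tensor_lift (\<lambda>a a'.
     tensor_lift (\<lambda>k a0. tensor_lift (\<lambda>k' a0'. (k * k') \<otimes> (a0 \<otimes> a0')) (rho a')) (rho a))"

definition delta_tensor :: "(sphere, sphere) tensor \<Rightarrow> ((sphere, sphere) tensor, H) tensor" where
  "delta_tensor = tensor_lift (\<lambda>a a'.
     tensor_lift (\<lambda>a0 h. tensor_lift (\<lambda>a0' h'. (a0 \<otimes> a0') \<otimes> (h * h')) (delta a')) (delta a))"

definition rho_quot :: "(sphere, sphere) tensor set \<Rightarrow> form \<Rightarrow> (K, form) tensor" where
  "rho_quot W = qlift W (\<lambda>x. tensor_map (\<lambda>k. k) (qproj W) (rho_tensor x))"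

definition delta_quot :: "(sphere, sphere) tensor set \<Rightarrow> form \<Rightarrow> (form, H) tensor" where
  "delta_quot W = qlift W (\<lambda>x. tensor_map (qproj W) (\<lambda>h. h) (delta_tensor x))"

definition Omega :: "form set" where "Omega = kaehler (*) (*)"
definition dA :: "sphere \<Rightarrow> form" where "dA = kaehler_d (*) (*)"
definition actA :: "sphere \<Rightarrow> form \<Rightarrow> form" where "actA = kaehler_act (*) (*)"
definition rho_Omega :: "form \<Rightarrow> (K, form) tensor" where "rho_Omega = rho_quot (mu_ker_sq (*) (*))"
definition delta_Omega :: "form \<Rightarrow> (form, H) tensor" where "delta_Omega = delta_quot (mu_ker_sq (*) (*))"

definition sq_theta :: "real \<Rightarrow> (sphere, sphere) tensor set" where
  "sq_theta \<theta> = mu_ker_sq (star_prod \<theta>) (braided_prod \<theta>)"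
definition Omega_theta :: "real \<Rightarrow> form set" where
  "Omega_theta \<theta> = kaehler (star_prod \<theta>) (braided_prod \<theta>)"
definition d_theta :: "real \<Rightarrow> sphere \<Rightarrow> form" where
  "d_theta \<theta> = kaehler_d (star_prod \<theta>) (braided_prod \<theta>)"
definition act_theta :: "real \<Rightarrow> sphere \<Rightarrow> form \<Rightarrow> form" where
  "act_theta \<theta> = kaehler_act (star_prod \<theta>) (braided_prod \<theta>)"
definition rho_Omega_theta :: "real \<Rightarrow> form \<Rightarrow> (K, form) tensor" where
  "rho_Omega_theta \<theta> = rho_quot (sq_theta \<theta>)"
definition delta_Omega_theta :: "real \<Rightarrow> form \<Rightarrow> (form, H) tensor" where
  "delta_Omega_theta \<theta> = delta_quot (sq_theta \<theta>)"

text \<open>\<open>\<Omega>\<^sup>1(A)\<^sub>\<theta>\<close> has the same underlying bicomodule as \<open>\<Omega>\<^sup>1(A)\<close>, and the deformed left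
  \<open>A\<^sub>\<theta>\<close>-action \<open>a \<star>\<^sub>\<theta> \<lambda>\<close>.\<close>

definition twist_act :: "real \<Rightarrow> sphere \<Rightarrow> form \<Rightarrow> form" where
  "twist_act \<theta> a \<xi> =
     tensor_lift (\<lambda>k a0. tensor_lift (\<lambda>k' l0. sigma \<theta> (k \<otimes> k') *\<^sub>C actA a0 l0) (rho_Omega \<xi>)) (rho a)"

text \<open>The map \<open>a d\<^sub>\<theta>a' \<mapsto> a \<star>\<^sub>\<theta> da'\<close>. An element \<open>\<Sum> a \<otimes> a'\<close> of \<open>ker \<mu>\<close> represents
  \<open>\<Sum> a d\<^sub>\<theta>a'\<close>.\<close>

definition phi :: "real \<Rightarrow> form \<Rightarrow> form" where
  "phi \<theta> = qlift (sq_theta \<theta>) (tensor_lift (\<lambda>a a'. twist_act \<theta> a (dA a')))"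

section \<open>Connections\<close>

definition verX :: "form \<Rightarrow> sphere" where
  "verX = qlift (mu_ker_sq (*) (*))
     (tensor_lift (\<lambda>a a'. tensor_lift (\<lambda>a0' h. X_H h *\<^sub>C (a * a0')) (delta a')))"

definition verX_theta :: "real \<Rightarrow> form \<Rightarrow> sphere" where
  "verX_theta \<theta> = qlift (sq_theta \<theta>)
     (tensor_lift (\<lambda>a a'. tensor_lift (\<lambda>a0' h. X_H h *\<^sub>C star_prod \<theta> a a0') (delta a')))"

definition Con :: "form set" where
  "Con = {\<omega> \<in> Omega. delta_Omega \<omega> = \<omega> \<otimes> 1 \<and> verX \<omega> = 1}"

definition Con_theta :: "real \<Rightarrow> form set" where
  "Con_theta \<theta> = {\<omega> \<in> Omega_theta \<theta>. delta_Omega_theta \<theta> \<omega> = \<omega> \<otimes> 1 \<and> verX_theta \<theta> \<omega> = 1}"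

text \<open>Isomorphisms \<open>\<Omega>\<^sup>1(A\<^sub>\<theta>) \<rightarrow> \<Omega>\<^sup>1(A)\<^sub>\<theta>\<close> of left \<open>A\<^sub>\<theta>\<close>-modules and
  \<open>(K, H)\<close>-bicomodules, given by a linear map \<open>f\<close> of the ambient space.\<close>

definition form_iso :: "real \<Rightarrow> (form \<Rightarrow> form) \<Rightarrow> bool" where
  "form_iso \<theta> f \<longleftrightarrow> clinear f \<and> bij_betw f (Omega_theta \<theta>) Omega \<and>
     (\<forall>a. \<forall>\<omega>\<in>Omega_theta \<theta>. f (act_theta \<theta> a \<omega>) = twist_act \<theta> a (f \<omega>)) \<and>
     (\<forall>\<omega>\<in>Omega_theta \<theta>. rho_Omega (f \<omega>) = tensor_map (\<lambda>k. k) f (rho_Omega_theta \<theta> \<omega>)) \<and>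
     (\<forall>\<omega>\<in>Omega_theta \<theta>. delta_Omega (f \<omega>) = tensor_map f (\<lambda>h. h) (delta_Omega_theta \<theta> \<omega>))"

section \<open>Well-definedness\<close>

text \<open>The products, coactions, left actions and vertical maps above, defined via \<^const>\<open>tensor_lift\<close>
  and \<^const>\<open>qlift\<close>, are independent of representatives. Identities are checked on homogeneous
  elements, which span \<open>A\<close>.\<close>

definition homog :: "sphere \<Rightarrow> int \<times> int \<Rightarrow> int \<Rightarrow> bool" where
  "homog a m n \<longleftrightarrow> rho a = tK m \<otimes> a \<and> delta a = a \<otimes> tH n"

lemma homog_mult: "homog a m n \<Longrightarrow> homog b m' n' \<Longrightarrow> homog (a * b) (m + m') (n + n')"
  by (simp add: homog_def rho_mult delta_mult times_tensor_tensor tK_mult tH_mult)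

lemma homog_1: "homog 1 0 0"
  by (simp add: homog_def rho_1 delta_1 one_tensor_def tK_0 tH_0)

lemma homog_scale: "homog a m n \<Longrightarrow> homog (c *\<^sub>C a) m n"
  by (simp add: homog_def clinear_simps[OF rho_clinear] clinear_simps[OF delta_clinear]
      tensor_scale_left tensor_scale_right)

lemma homog_gen: "\<exists>m n. homog (gen_elt v) m n"
  by (cases v) (auto simp: homog_def rho_gen_elt delta_gen_elt)

definition is_homog :: "sphere \<Rightarrow> bool" where "is_homog a \<longleftrightarrow> (\<exists>m n. homog a m n)"

lemma is_homog_mult: "is_homog a \<Longrightarrow> is_homog b \<Longrightarrow> is_homog (a * b)"
  unfolding is_homog_def using homog_mult by blast

lemma is_homog_power: "is_homog a \<Longrightarrow> is_homog (a ^ k)"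
proof (induction k)
  case 0
  show ?case unfolding is_homog_def power_0 by (intro exI, rule homog_1)
qed (simp add: is_homog_mult)

lemma abs_sphere_mult: "abs_sphere (p * q) = abs_sphere p * abs_sphere q"
  by (simp add: times_sphere.abs_eq)

lemma abs_sphere_single: "abs_sphere (Poly_Mapping.single m 1) = (\<Prod>v\<in>UNIV. gen_elt v ^ Poly_Mapping.lookup m v)"
proof -
  have "gen_elt v ^ k = abs_sphere (Poly_Mapping.single (Poly_Mapping.single v k) 1)" for v k
    by (induction k) (simp_all add: one_sphere.abs_eq gen_elt.abs_eq pvar_def mult_single flip: abs_sphere_mult single_add)
  moreover have "(\<Sum>v\<in>UNIV. Poly_Mapping.single v (Poly_Mapping.lookup m v)) = m"
  proof (rule poly_mapping_eqI)
    fix w show "Poly_Mapping.lookup (\<Sum>v\<in>UNIV. Poly_Mapping.single v (Poly_Mapping.lookup m v)) w = Poly_Mapping.lookup m w"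
      unfolding UNIV_gen by (cases w) (simp_all add: lookup_add lookup_single)
  qed
  ultimately show ?thesis
    unfolding UNIV_gen by (simp add: mult_single add.assoc flip: abs_sphere_mult)
qed

lemma abs_sphere_clinear: "clinear abs_sphere"
  by (rule clinearI) (simp_all add: plus_sphere.abs_eq scaleC_sphere.abs_eq)

lemma sphere_induct [case_names homog add]:
  assumes "\<And>a m n. homog a m n \<Longrightarrow> P a" and "\<And>a b. P a \<Longrightarrow> P b \<Longrightarrow> P (a + b)"
  shows "P a"
proof -
  have "is_homog (abs_sphere (Poly_Mapping.single m 1))" for m
  proof -
    have "is_homog (gen_elt v ^ Poly_Mapping.lookup m v)" for v
      using homog_gen by (intro is_homog_power) (simp add: is_homog_def)
    then show ?thesis
      unfolding abs_sphere_single UNIV_gen by (simp add: is_homog_mult)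
  qed
  then have s: "P (c *\<^sub>C abs_sphere (Poly_Mapping.single m 1))" for m c
    unfolding is_homog_def using assms(1) homog_scale by metis
  have P0: "P 0" using s[of 0] by simp
  obtain p where a: "a = abs_sphere p"
    by (metis Quotient3_abs_rep[OF Quotient3_sphere])
  have "P (\<Sum>m\<in>S. Poly_Mapping.lookup p m *\<^sub>C abs_sphere (Poly_Mapping.single m 1))" for S
    by (induction S rule: infinite_finite_induct) (auto simp: P0 s assms(2))
  moreover have "a = (\<Sum>m\<in>Poly_Mapping.keys p. Poly_Mapping.lookup p m *\<^sub>C abs_sphere (Poly_Mapping.single m 1))"
    using arg_cong[OF poly_mapping_decomp, of abs_sphere p]
    by (simp add: a lin_ext_def clinear_simps[OF abs_sphere_clinear])
  ultimately show ?thesis by metis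
qed

lemma tensor_homog_induct [case_names homog add]:
  assumes h: "\<And>a a' m n m' n'. homog a m n \<Longrightarrow> homog a' m' n' \<Longrightarrow> P (a \<otimes> a')"
    and add: "\<And>x y. P x \<Longrightarrow> P y \<Longrightarrow> P (x + y)"
  shows "P x"
proof (induction x)
  case (pure a b)
  have "homog a m n \<Longrightarrow> P (a \<otimes> b)" for a m n
    by (induction b rule: sphere_induct) (auto simp: tensor_add_right intro: h add)
  then show ?case
    by (induction a rule: sphere_induct) (auto simp: tensor_add_left intro: add)
qed (rule add)

lemma cbilinear_K_form: "cbilinear (\<lambda>k l. lin_ext (\<lambda>m. lin_ext (c m) l) k :: complex)"
proof (intro cbilinearI clinear_intros)
  fix k :: "'a \<Rightarrow>\<^sub>0 complex"
  show "clinear (\<lambda>l. lin_ext (\<lambda>m. lin_ext (c m) l) k)"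
    unfolding lin_ext_def[of _ k]
    by (intro clinearI)
      (simp_all add: clinear_simps[OF lin_ext_clinear] scaleC_add_right sum.distrib cvec.scale_sum_right mult.commute)
qed

lemma K_form_clinear: "clinear (K_form c)"
  unfolding K_form_def by (intro clinear_intros cbilinear_K_form)

lemma K_form_tK: "K_form c (tK m \<otimes> tK n) = c m n"
  unfolding K_form_def tensor_lift_tensor[OF cbilinear_K_form] by (simp add: tK_def scaleC_one)

lemma sigma_clinear: "clinear g \<Longrightarrow> clinear (\<lambda>x. sigma \<theta> (g x))"
  and R_mat_clinear: "clinear g \<Longrightarrow> clinear (\<lambda>x. R_mat \<theta> (g x))"
  unfolding sigma_def R_mat_def by (rule K_form_clinear[THEN clinear_compose]; assumption)+

lemma sigma_tK: "sigma \<theta> (tK m \<otimes> tK n) = sigma_coeff \<theta> m n"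
  and R_mat_tK: "R_mat \<theta> (tK m \<otimes> tK n) = R_coeff \<theta> m n"
  unfolding sigma_def R_mat_def K_form_tK by simp_all

lemma sigma_coeff_add:
  "sigma_coeff \<theta> (m + m') n = sigma_coeff \<theta> m n * sigma_coeff \<theta> m' n"
  "sigma_coeff \<theta> m (n + n') = sigma_coeff \<theta> m n * sigma_coeff \<theta> m n'"
  "sigma_coeff \<theta> 0 n = 1" "sigma_coeff \<theta> m 0 = 1"
  by (simp_all add: sigma_coeff_def algebra_simps flip: exp_add)

lemma R_coeff_sigma: "R_coeff \<theta> m n * sigma_coeff \<theta> m n = sigma_coeff \<theta> n m"
  "sigma_coeff \<theta> m n * sigma_coeff \<theta> n m = 1"
  by (simp_all add: R_coeff_def sigma_coeff_def algebra_simps flip: exp_add)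

lemmas coact_lin = rho_clinear[THEN clinear_compose] delta_clinear[THEN clinear_compose]
  sigma_clinear R_mat_clinear

lemma star_prod_clinear_left: "clinear f \<Longrightarrow> clinear (\<lambda>x. star_prod \<theta> (f x) b)"
  and star_prod_clinear_right: "clinear f \<Longrightarrow> clinear (\<lambda>x. star_prod \<theta> b (f x))"
  unfolding star_prod_def by (intro clinear_intros coact_lin; assumption)+

lemmas sp_lin = star_prod_clinear_left star_prod_clinear_right

lemma star_prod_homog:
  "homog a m n \<Longrightarrow> homog b m' n' \<Longrightarrow> star_prod \<theta> a b = sigma_coeff \<theta> m m' *\<^sub>C (a * b)"
  unfolding star_prod_def homog_def
  by (simp, (subst tensor_lift_tensor, (intro clinear_intros coact_lin)[1])+, simp add: sigma_tK)

lemma braided_prod_clinear_left: "clinear f \<Longrightarrow> clinear (\<lambda>x. braided_prod \<theta> (f x) y)"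
  and braided_prod_clinear_right: "clinear f \<Longrightarrow> clinear (\<lambda>x. braided_prod \<theta> y (f x))"
  unfolding braided_prod_def by (intro clinear_intros coact_lin sp_lin; assumption)+

lemma braided_prod_homog:
  assumes "homog a m1 n1" "homog a' m2 n2" "homog b m3 n3" "homog b' m4 n4"
  shows "braided_prod \<theta> (a \<otimes> a') (b \<otimes> b') =
    (R_coeff \<theta> m3 m2 * sigma_coeff \<theta> m1 m3 * sigma_coeff \<theta> m2 m4) *\<^sub>C ((a * b) \<otimes> (a' * b'))"
proof -
  have rho: "rho a' = tK m2 \<otimes> a'" "rho b = tK m3 \<otimes> b"
    using assms by (auto simp: homog_def)
  show ?thesis
    unfolding braided_prod_def
    by ((subst tensor_lift_tensor, (intro clinear_intros coact_lin sp_lin)[1])+,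
      simp add: rho, (subst tensor_lift_tensor, (intro clinear_intros coact_lin sp_lin)[1])+,
      simp add: R_mat_tK star_prod_homog[OF assms(1,3)] star_prod_homog[OF assms(2,4)]
        tensor_scale_left tensor_scale_right mult_ac)
qed


lemmas star_prod_simps = clinear_simps[OF star_prod_clinear_left[OF clinear_id]]
  clinear_simps[OF star_prod_clinear_right[OF clinear_id]]

lemmas braided_simps = clinear_simps[OF braided_prod_clinear_left[OF clinear_id]]
  clinear_simps[OF braided_prod_clinear_right[OF clinear_id]]

lemmas all_lin = clinear_intros coact_lin sp_lin braided_prod_clinear_left braided_prod_clinear_right

lemma star_prod_assoc: "star_prod \<theta> (star_prod \<theta> a b) c = star_prod \<theta> a (star_prod \<theta> b c)"
proof -
  have 1: "star_prod \<theta> (star_prod \<theta> a b) c = star_prod \<theta> a (star_prod \<theta> b c)"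
    if "homog a m1 n1" "homog b m2 n2" "homog c m3 n3" for a b c m1 n1 m2 n2 m3 n3
    by (simp add: star_prod_homog[OF that(1,2)] star_prod_homog[OF that(2,3)]
        star_prod_homog[OF homog_mult[OF that(1,2)] that(3)] star_prod_homog[OF that(1) homog_mult[OF that(2,3)]]
        star_prod_simps sigma_coeff_add mult_ac)
  have 2: "star_prod \<theta> (star_prod \<theta> a b) c = star_prod \<theta> a (star_prod \<theta> b c)"
    if "homog a m1 n1" "homog b m2 n2" for a b m1 n1 m2 n2
    by (induction c rule: sphere_induct) (auto intro: 1 that simp: star_prod_simps)
  have 3: "star_prod \<theta> (star_prod \<theta> a b) c = star_prod \<theta> a (star_prod \<theta> b c)"
    if "homog a m1 n1" for a m1 n1
    by (induction b rule: sphere_induct) (auto intro: 2 that simp: star_prod_simps)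
  show ?thesis
    by (induction a rule: sphere_induct) (auto intro: 3 simp: star_prod_simps)
qed

lemma star_prod_1: "star_prod \<theta> 1 a = a" "star_prod \<theta> a 1 = a"
proof -
  have "star_prod \<theta> 1 a = a \<and> star_prod \<theta> a 1 = a"
  proof (induction a rule: sphere_induct)
    case (homog a m n)
    then show ?case
      using star_prod_homog[OF homog_1 homog, of \<theta>] star_prod_homog[OF homog homog_1, of \<theta>]
      by (simp add: sigma_coeff_add scaleC_one)
  qed (simp add: star_prod_simps)
  then show "star_prod \<theta> 1 a = a" "star_prod \<theta> a 1 = a" by auto
qed

lemma sigma_coeff_0: "sigma_coeff 0 m n = 1" and R_coeff_0: "R_coeff 0 m n = 1"
  by (simp_all add: sigma_coeff_def R_coeff_def)

lemma star_prod_0: "star_prod 0 = (*)"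
proof (intro ext)
  fix a b
  have "homog a m n \<Longrightarrow> star_prod 0 a b = a * b" for a m n
    by (induction b rule: sphere_induct)
      (simp_all add: star_prod_homog star_prod_simps sigma_coeff_0 scaleC_one distrib_left)
  then show "star_prod 0 a b = a * b"
    by (induction a rule: sphere_induct) (simp_all add: star_prod_simps distrib_right)
qed

text \<open>Linear identities in two arguments in \<open>A \<otimes> A\<close> can be checked on homogeneous elements.\<close>

lemma clinear_homog_eqI:
  assumes "clinear f" "clinear g"
    and "\<And>a a' m n m' n'. homog a m n \<Longrightarrow> homog a' m' n' \<Longrightarrow> f (a \<otimes> a') = g (a \<otimes> a')"
  shows "f x = g x"
  by (induction x rule: tensor_homog_induct)
    (auto intro: assms(3) simp: clinear_add[OF assms(1)] clinear_add[OF assms(2)])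

lemma clinear2_homog_eqI:
  assumes "\<And>y. clinear (\<lambda>x. f x y)" "\<And>y. clinear (\<lambda>x. g x y)" "\<And>x. clinear (f x)" "\<And>x. clinear (g x)"
    and "\<And>a a' b b' m1 m2 m3 m4 n1 n2 n3 n4. homog a m1 n1 \<Longrightarrow> homog a' m2 n2 \<Longrightarrow>
      homog b m3 n3 \<Longrightarrow> homog b' m4 n4 \<Longrightarrow> f (a \<otimes> a') (b \<otimes> b') = g (a \<otimes> a') (b \<otimes> b')"
  shows "f x y = g x y"
proof (rule clinear_homog_eqI[where x = x])
  fix a a' m n m' n' assume a: "homog a m n" "homog a' m' n'"
  show "f (a \<otimes> a') y = g (a \<otimes> a') y"
    by (rule clinear_homog_eqI[where x = y]) (auto intro: assms a)
qed (auto intro: assms)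

lemma braided_prod_0: "braided_prod 0 = (*)"
proof (intro ext)
  fix x y show "braided_prod 0 x y = x * y"
    by (rule clinear2_homog_eqI[where x = x and y = y]; (intro all_lin)?)
      (simp add: braided_prod_homog sigma_coeff_0 R_coeff_0 scaleC_one times_tensor_tensor)
qed

definition mu_theta :: "real \<Rightarrow> (sphere, sphere) tensor \<Rightarrow> sphere" where
  "mu_theta \<theta> = tensor_lift (star_prod \<theta>)"

definition ver_tensor :: "real \<Rightarrow> (sphere, sphere) tensor \<Rightarrow> sphere" where
  "ver_tensor \<theta> = tensor_lift (\<lambda>a a'. tensor_lift (\<lambda>a0' h. X_H h *\<^sub>C star_prod \<theta> a a0') (delta a'))"

lemma cbilinear_star_prod: "cbilinear (star_prod \<theta>)"
  by (intro all_lin)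

lemma mu_theta_clinear: "clinear g \<Longrightarrow> clinear (\<lambda>x. mu_theta \<theta> (g x))"
  unfolding mu_theta_def by (intro all_lin cbilinear_star_prod; assumption)

lemma mu_theta_tensor: "mu_theta \<theta> (a \<otimes> a') = star_prod \<theta> a a'"
  unfolding mu_theta_def by (rule tensor_lift_tensor[OF cbilinear_star_prod])

lemmas X_lin = X_H_clinear[THEN clinear_compose]

lemma cbilinear_ver: "cbilinear (\<lambda>a a'. tensor_lift (\<lambda>a0' h. X_H h *\<^sub>C star_prod \<theta> a a0') (delta a'))"
  by (intro all_lin X_lin)

lemma ver_tensor_clinear: "clinear g \<Longrightarrow> clinear (\<lambda>x. ver_tensor \<theta> (g x))"
  unfolding ver_tensor_def by (intro all_lin X_lin; assumption)

lemma ver_tensor_homog: "homog a' m n \<Longrightarrow> ver_tensor \<theta> (a \<otimes> a') = of_int n *\<^sub>C star_prod \<theta> a a'"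
  unfolding ver_tensor_def tensor_lift_tensor[OF cbilinear_ver] homog_def
  by (simp, subst tensor_lift_tensor, (intro all_lin X_lin)[1], simp add: X_H_tH)

lemma star_braid:
  "homog b m n \<Longrightarrow> homog a' m' n' \<Longrightarrow> R_coeff \<theta> m m' *\<^sub>C star_prod \<theta> b a' = star_prod \<theta> a' b"
  by (simp add: star_prod_homog R_coeff_sigma mult.commute[of b])

lemma braided_prod_star:
  assumes "homog a m1 n1" "homog a' m2 n2" "homog b m3 n3" "homog b' m4 n4"
  shows "braided_prod \<theta> (a \<otimes> a') (b \<otimes> b') = R_coeff \<theta> m3 m2 *\<^sub>C (star_prod \<theta> a b \<otimes> star_prod \<theta> a' b')"
  using assms by (simp add: braided_prod_homog star_prod_homog tensor_scale_left tensor_scale_right mult_ac)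

lemma star_prod_homog_closed: "homog a m n \<Longrightarrow> homog b m' n' \<Longrightarrow> homog (star_prod \<theta> a b) (m + m') (n + n')"
  by (simp add: star_prod_homog homog_mult homog_scale)

lemma mu_theta_braided: "mu_theta \<theta> (braided_prod \<theta> x y) = star_prod \<theta> (mu_theta \<theta> x) (mu_theta \<theta> y)"
proof (rule clinear2_homog_eqI[where x = x and y = y]; (intro all_lin mu_theta_clinear)?)
  fix a a' b b' m1 m2 m3 m4 n1 n2 n3 n4
  assume h: "homog a m1 n1" "homog a' m2 n2" "homog b m3 n3" "homog b' m4 n4"
  have "R_coeff \<theta> m3 m2 *\<^sub>C star_prod \<theta> (star_prod \<theta> a b) (star_prod \<theta> a' b') =
      star_prod \<theta> a (star_prod \<theta> (R_coeff \<theta> m3 m2 *\<^sub>C star_prod \<theta> b a') b')"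
    by (simp add: star_prod_assoc star_prod_simps)
  then show "mu_theta \<theta> (braided_prod \<theta> (a \<otimes> a') (b \<otimes> b')) =
      star_prod \<theta> (mu_theta \<theta> (a \<otimes> a')) (mu_theta \<theta> (b \<otimes> b'))"
    by (simp add: braided_prod_star[OF h] clinear_simps[OF mu_theta_clinear[OF clinear_id]]
        mu_theta_tensor star_braid[OF h(3,2)] star_prod_assoc)
qed

lemma ver_tensor_braided: "ver_tensor \<theta> (braided_prod \<theta> x y) =
  star_prod \<theta> (ver_tensor \<theta> x) (mu_theta \<theta> y) + star_prod \<theta> (mu_theta \<theta> x) (ver_tensor \<theta> y)"
proof (rule clinear2_homog_eqI[where x = x and y = y]; (intro all_lin mu_theta_clinear ver_tensor_clinear)?)
  fix a a' b b' m1 m2 m3 m4 n1 n2 n3 n4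
  assume h: "homog a m1 n1" "homog a' m2 n2" "homog b m3 n3" "homog b' m4 n4"
  have "R_coeff \<theta> m3 m2 *\<^sub>C star_prod \<theta> (star_prod \<theta> a b) (star_prod \<theta> a' b') =
      star_prod \<theta> a (star_prod \<theta> (R_coeff \<theta> m3 m2 *\<^sub>C star_prod \<theta> b a') b')"
    by (simp add: star_prod_assoc star_prod_simps)
  then have *: "R_coeff \<theta> m3 m2 *\<^sub>C star_prod \<theta> (star_prod \<theta> a b) (star_prod \<theta> a' b') =
      star_prod \<theta> (star_prod \<theta> a a') (star_prod \<theta> b b')"
    by (simp add: star_braid[OF h(3,2)] star_prod_assoc)
  show "ver_tensor \<theta> (braided_prod \<theta> (a \<otimes> a') (b \<otimes> b')) =
    star_prod \<theta> (ver_tensor \<theta> (a \<otimes> a')) (mu_theta \<theta> (b \<otimes> b')) +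
    star_prod \<theta> (mu_theta \<theta> (a \<otimes> a')) (ver_tensor \<theta> (b \<otimes> b'))"
    unfolding braided_prod_star[OF h] clinear_scale[OF ver_tensor_clinear[OF clinear_id]]
      ver_tensor_homog[OF star_prod_homog_closed[OF h(2,4)]] ver_tensor_homog[OF h(2)] ver_tensor_homog[OF h(4)]
      mu_theta_tensor
    unfolding star_prod_simps of_int_add scaleC_add_left[symmetric]
    by (subst cvec.scale_left_commute) (simp only: * star_prod_simps flip: scaleC_add_left)
qed

lemma mu_ker_theta: "x \<in> mu_ker (star_prod \<theta>) \<longleftrightarrow> mu_theta \<theta> x = 0"
  by (simp add: mu_ker_def mu_theta_def)

lemma ver_tensor_sq: "w \<in> sq_theta \<theta> \<Longrightarrow> ver_tensor \<theta> w = 0"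
  unfolding sq_theta_def mu_ker_sq_def
proof (induction rule: cvec.span_induct)
  case base
  show ?case
    by (rule cvec.subspaceI) (simp_all add: clinear_simps[OF ver_tensor_clinear[OF clinear_id]])
qed (auto simp: mu_ker_theta ver_tensor_braided star_prod_simps)

lemma sq_theta_0: "sq_theta 0 = mu_ker_sq (*) (*)"
  by (simp add: sq_theta_def star_prod_0 braided_prod_0)


lemma cbilinear_rho_tensor: "cbilinear (\<lambda>a a'.
    tensor_lift (\<lambda>k a0. tensor_lift (\<lambda>k' a0'. (k * k') \<otimes> (a0 \<otimes> a0')) (rho a')) (rho a))"
  by (intro all_lin)

lemma cbilinear_delta_tensor: "cbilinear (\<lambda>a a'.
     tensor_lift (\<lambda>a0 h. tensor_lift (\<lambda>a0' h'. (a0 \<otimes> a0') \<otimes> (h * h')) (delta a')) (delta a))"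
  by (intro all_lin)

lemma rho_tensor_clinear: "clinear g \<Longrightarrow> clinear (\<lambda>x. rho_tensor (g x))"
  unfolding rho_tensor_def by (intro all_lin; assumption)

lemma delta_tensor_clinear: "clinear g \<Longrightarrow> clinear (\<lambda>x. delta_tensor (g x))"
  unfolding delta_tensor_def by (intro all_lin; assumption)

lemmas all_lin2 = all_lin mu_theta_clinear ver_tensor_clinear rho_tensor_clinear delta_tensor_clinear

definition bihom :: "(sphere, sphere) tensor \<Rightarrow> int \<times> int \<Rightarrow> int \<Rightarrow> bool" where
  "bihom x m n \<longleftrightarrow> rho_tensor x = tK m \<otimes> x \<and> delta_tensor x = x \<otimes> tH n"

lemma bihom_tensor: "homog a m n \<Longrightarrow> homog a' m' n' \<Longrightarrow> bihom (a \<otimes> a') (m + m') (n + n')"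
  unfolding bihom_def rho_tensor_def delta_tensor_def homog_def
    tensor_lift_tensor[OF cbilinear_rho_tensor] tensor_lift_tensor[OF cbilinear_delta_tensor]
  by (simp, (subst tensor_lift_tensor, (intro all_lin)[1])+, simp add: tK_mult tH_mult)

lemma bihom_scale: "bihom x m n \<Longrightarrow> bihom (c *\<^sub>C x) m n"
  by (simp add: bihom_def clinear_simps[OF rho_tensor_clinear[OF clinear_id]]
     clinear_simps[OF delta_tensor_clinear[OF clinear_id]] tensor_scale_left tensor_scale_right)

lemma bihom_diff: "bihom x m n \<Longrightarrow> bihom y m n \<Longrightarrow> bihom (x - y) m n"
  by (simp add: bihom_def clinear_simps[OF rho_tensor_clinear[OF clinear_id]]
     clinear_simps[OF delta_tensor_clinear[OF clinear_id]] clinear_simps[OF tensor_clinear_left]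
     clinear_simps[OF tensor_clinear_right])

lemma lookup_clinear: "clinear g \<Longrightarrow> clinear (\<lambda>x. Poly_Mapping.lookup (g x :: 'k \<Rightarrow>\<^sub>0 complex) m)"
  by (rule clinearI) (simp_all add: clinear_simps lookup_add lookup_scaleC)

definition hcomp :: "int \<times> int \<Rightarrow> int \<Rightarrow> (sphere, sphere) tensor \<Rightarrow> (sphere, sphere) tensor" where
  "hcomp m n x = tensor_lift (\<lambda>k y. Poly_Mapping.lookup k m *\<^sub>C
     tensor_lift (\<lambda>z h. Poly_Mapping.lookup h n *\<^sub>C z) (delta_tensor y)) (rho_tensor x)"

definition compA :: "int \<times> int \<Rightarrow> int \<Rightarrow> sphere \<Rightarrow> sphere" where
  "compA m n x = tensor_lift (\<lambda>k y. Poly_Mapping.lookup k m *\<^sub>C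
     tensor_lift (\<lambda>z h. Poly_Mapping.lookup h n *\<^sub>C z) (delta y)) (rho x)"

lemma hcomp_clinear: "clinear g \<Longrightarrow> clinear (\<lambda>x. hcomp m n (g x))"
  unfolding hcomp_def by (intro all_lin2 lookup_clinear; assumption)

lemma compA_clinear: "clinear g \<Longrightarrow> clinear (\<lambda>x. compA m n (g x))"
  unfolding compA_def by (intro all_lin2 lookup_clinear; assumption)

lemma hcomp_bihom: "bihom x m' n' \<Longrightarrow> hcomp m n x = (if m = m' \<and> n = n' then x else 0)"
  unfolding hcomp_def bihom_def
  by (simp, (subst tensor_lift_tensor, (intro all_lin2 lookup_clinear)[1])+, simp,
      (subst tensor_lift_tensor, (intro all_lin2 lookup_clinear)[1])+,
      auto simp: tK_def tH_def lookup_single when_def scaleC_one)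

lemma compA_homog: "homog x m' n' \<Longrightarrow> compA m n x = (if m = m' \<and> n = n' then x else 0)"
  unfolding compA_def homog_def
  by (simp, (subst tensor_lift_tensor, (intro all_lin2 lookup_clinear)[1])+, simp,
      (subst tensor_lift_tensor, (intro all_lin2 lookup_clinear)[1])+,
      auto simp: tK_def tH_def lookup_single when_def scaleC_one)

lemma bihom_hcomp: "bihom (hcomp m n x) m n"
proof -
  note lin = all_lin2 hcomp_clinear
  have *: "bihom (hcomp m n (a \<otimes> a')) m n" if "homog a k l" "homog a' k' l'" for a a' k l k' l'
    using hcomp_bihom[OF bihom_tensor[OF that], of m n] bihom_tensor[OF that] bihom_scale[of _ _ _ 0]
    by (auto simp: bihom_def clinear_simps[OF rho_tensor_clinear[OF clinear_id]]
     clinear_simps[OF delta_tensor_clinear[OF clinear_id]] clinear_simps[OF tensor_clinear_left]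
     clinear_simps[OF tensor_clinear_right])
  have "rho_tensor (hcomp m n x) = tK m \<otimes> hcomp m n x"
    by (rule clinear_homog_eqI[where x = x]; (intro lin)?) (use * in \<open>auto simp: bihom_def\<close>)
  moreover have "delta_tensor (hcomp m n x) = hcomp m n x \<otimes> tH n"
    by (rule clinear_homog_eqI[where x = x]; (intro lin)?) (use * in \<open>auto simp: bihom_def\<close>)
  ultimately show ?thesis by (simp add: bihom_def)
qed

lemma hcomp_decomp: "\<exists>S. finite S \<and> x = (\<Sum>(m, n)\<in>S. hcomp m n x)"
proof -
  have "\<exists>S. finite S \<and> (\<forall>T. finite T \<and> S \<subseteq> T \<longrightarrow> x = (\<Sum>(m, n)\<in>T. hcomp m n x))"
  proof (induction x rule: tensor_homog_induct)
    case (homog a a' m n m' n')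
    let ?p = "(m + m', n + n')"
    have "a \<otimes> a' = (\<Sum>(k, l)\<in>T. hcomp k l (a \<otimes> a'))" if "finite T" "{?p} \<subseteq> T" for T
    proof -
      have "(\<Sum>(k, l)\<in>T. hcomp k l (a \<otimes> a')) = (\<Sum>q\<in>T. if q = ?p then a \<otimes> a' else 0)"
        by (rule sum.cong) (simp_all add: hcomp_bihom[OF bihom_tensor[OF homog]] case_prod_beta prod_eq_iff)
      then show ?thesis using that by simp
    qed
    then show ?case by (intro exI[of _ "{?p}"]) simp
  next
    case (add x y)
    then obtain S S' where S: "finite S" "\<And>T. finite T \<and> S \<subseteq> T \<Longrightarrow> x = (\<Sum>(m, n)\<in>T. hcomp m n x)"
      and S': "finite S'" "\<And>T. finite T \<and> S' \<subseteq> T \<Longrightarrow> y = (\<Sum>(m, n)\<in>T. hcomp m n y)"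
      by blast
    have "x + y = (\<Sum>(m, n)\<in>T. hcomp m n (x + y))" if "finite T" "S \<union> S' \<subseteq> T" for T
    proof -
      have "x = (\<Sum>(m, n)\<in>T. hcomp m n x)" "y = (\<Sum>(m, n)\<in>T. hcomp m n y)"
        using S(2)[of T] S'(2)[of T] that by auto
      then have "x + y = (\<Sum>(m, n)\<in>T. hcomp m n x) + (\<Sum>(m, n)\<in>T. hcomp m n y)" by metis
      also have "\<dots> = (\<Sum>(m, n)\<in>T. hcomp m n (x + y))"
        by (simp add: case_prod_beta clinear_simps[OF hcomp_clinear[OF clinear_id]] sum.distrib)
      finally show ?thesis .
    qed
    then show ?case using S(1) S'(1) by (intro exI[of _ "S \<union> S'"]) simp
  qed
  then show ?thesis by blast
qed

lemma mu_theta_hcomp: "mu_theta \<theta> (hcomp m n x) = compA m n (mu_theta \<theta> x)"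
proof (rule clinear_homog_eqI[where x = x]; (intro all_lin2 hcomp_clinear compA_clinear)?)
  fix a a' k l k' l' assume h: "homog a k l" "homog a' k' l'"
  show "mu_theta \<theta> (hcomp m n (a \<otimes> a')) = compA m n (mu_theta \<theta> (a \<otimes> a'))"
    by (simp add: hcomp_bihom[OF bihom_tensor[OF h]] mu_theta_tensor compA_homog[OF star_prod_homog_closed[OF h]]
        clinear_simps[OF mu_theta_clinear[OF clinear_id]])
qed

lemma sq_theta_kill:
  assumes f: "clinear f" and w: "w \<in> sq_theta \<theta>"
    and h: "\<And>x y m n m' n'. bihom x m n \<Longrightarrow> bihom y m' n' \<Longrightarrow> mu_theta \<theta> x = 0 \<Longrightarrow> mu_theta \<theta> y = 0 \<Longrightarrow>
      f (braided_prod \<theta> x y) = 0"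
  shows "f w = 0"
  using w unfolding sq_theta_def mu_ker_sq_def
proof (induction rule: cvec.span_induct)
  case base
  show ?case
    by (rule cvec.subspaceI) (simp_all add: clinear_simps[OF f])
next
  case (step w)
  then obtain x y where w: "w = braided_prod \<theta> x y" and xy: "mu_theta \<theta> x = 0" "mu_theta \<theta> y = 0"
    by (auto simp: mu_ker_theta)
  obtain S T where x: "x = (\<Sum>(m, n)\<in>S. hcomp m n x)" and y: "y = (\<Sum>(m, n)\<in>T. hcomp m n y)"
    using hcomp_decomp by metis
  have "f (braided_prod \<theta> (\<Sum>(m, n)\<in>S. hcomp m n x) (\<Sum>(m, n)\<in>T. hcomp m n y)) =
      (\<Sum>(m, n)\<in>S. \<Sum>(m', n')\<in>T. f (braided_prod \<theta> (hcomp m n x) (hcomp m' n' y)))"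
    by (simp add: case_prod_beta braided_simps clinear_simps[OF f]) (rule sum.swap)
  also have "\<dots> = 0"
    by (intro sum.neutral ballI)
      (auto simp: case_prod_beta intro!: sum.neutral h bihom_hcomp
        simp: mu_theta_hcomp xy clinear_simps[OF compA_clinear[OF clinear_id]])
  finally show ?case
    using x y w by simp
qed

lemma sq_theta_in: "mu_theta \<theta> x = 0 \<Longrightarrow> mu_theta \<theta> y = 0 \<Longrightarrow> braided_prod \<theta> x y \<in> sq_theta \<theta>"
  unfolding sq_theta_def mu_ker_sq_def by (rule cvec.span_base) (auto simp: mu_ker_theta)

lemma braided_bihom:
  assumes "bihom x m n" "bihom y m' n'"
  shows "bihom (braided_prod \<theta> x y) (m + m') (n + n')"
proof -
  have "rho_tensor (braided_prod \<theta> x y) =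
      tensor_lift (\<lambda>k x0. tensor_lift (\<lambda>l y0. (k * l) \<otimes> braided_prod \<theta> x0 y0) (rho_tensor y)) (rho_tensor x)"
    for x y
  proof (rule clinear2_homog_eqI[where x = x and y = y]; (intro all_lin2)?)
    fix a a' b b' m1 m2 m3 m4 n1 n2 n3 n4
    assume h: "homog a m1 n1" "homog a' m2 n2" "homog b m3 n3" "homog b' m4 n4"
    note b = bihom_tensor[OF h(1,2)] bihom_tensor[OF h(3,4)]
      bihom_tensor[OF homog_mult[OF h(1,3)] homog_mult[OF h(2,4)]]
    note r = b[unfolded bihom_def, THEN conjunct1]
    show "rho_tensor (braided_prod \<theta> (a \<otimes> a') (b \<otimes> b')) = tensor_lift (\<lambda>k x0. tensor_lift
      (\<lambda>l y0. (k * l) \<otimes> braided_prod \<theta> x0 y0) (rho_tensor (b \<otimes> b'))) (rho_tensor (a \<otimes> a'))"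
      unfolding r(1,2)
      by ((subst tensor_lift_tensor, (intro all_lin2)[1])+)
        (simp add: braided_prod_homog[OF h] r(3) clinear_simps[OF rho_tensor_clinear[OF clinear_id]]
          tK_mult tensor_scale_right add_ac)
  qed
  note r = this
  have "delta_tensor (braided_prod \<theta> x y) =
      tensor_lift (\<lambda>x0 k. tensor_lift (\<lambda>y0 l. braided_prod \<theta> x0 y0 \<otimes> (k * l)) (delta_tensor y)) (delta_tensor x)"
    for x y
  proof (rule clinear2_homog_eqI[where x = x and y = y]; (intro all_lin2)?)
    fix a a' b b' m1 m2 m3 m4 n1 n2 n3 n4
    assume h: "homog a m1 n1" "homog a' m2 n2" "homog b m3 n3" "homog b' m4 n4"
    note b = bihom_tensor[OF h(1,2)] bihom_tensor[OF h(3,4)]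
      bihom_tensor[OF homog_mult[OF h(1,3)] homog_mult[OF h(2,4)]]
    note r = b[unfolded bihom_def, THEN conjunct2]
    show "delta_tensor (braided_prod \<theta> (a \<otimes> a') (b \<otimes> b')) = tensor_lift (\<lambda>x0 k. tensor_lift
      (\<lambda>y0 l. braided_prod \<theta> x0 y0 \<otimes> (k * l)) (delta_tensor (b \<otimes> b'))) (delta_tensor (a \<otimes> a'))"
      unfolding r(1,2)
      by ((subst tensor_lift_tensor, (intro all_lin2)[1])+)
        (simp add: braided_prod_homog[OF h] r(3) clinear_simps[OF delta_tensor_clinear[OF clinear_id]]
          tH_mult tensor_scale_left add_ac)
  qed
  note d = this
  show ?thesis
    using assms unfolding bihom_def r d
    by (simp, (subst tensor_lift_tensor, (intro all_lin2)[1])+, simp add: tK_mult tH_mult)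
qed

lemma tensor_map_clinear:
  assumes "clinear f" "clinear f'" "clinear g"
  shows "clinear (\<lambda>x. tensor_map f f' (g x))"
  unfolding tensor_map_def
  by (intro clinear_tensor_lift clinear_tensor_left clinear_tensor_right cbilinearI assms)

lemma tensor_map_tensor:
  assumes "clinear f" "clinear f'"
  shows "tensor_map f f' (a \<otimes> b) = f a \<otimes> f' b"
  unfolding tensor_map_def
  by (intro tensor_lift_tensor clinear_tensor_left clinear_tensor_right cbilinearI assms)

lemma qproj_lin: "clinear g \<Longrightarrow> clinear (\<lambda>x. qproj W (g x))"
  by (rule clinear_compose[OF qproj_clinear])

lemma qproj_sq: "w \<in> W \<Longrightarrow> qproj W w = 0"
  by (simp add: qproj_eq_0_iff cvec.span_base)

lemma
  shows rho_quot_clinear: "clinear (rho_quot (sq_theta \<theta>))"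
    and rho_quot_qproj: "rho_quot (sq_theta \<theta>) (qproj (sq_theta \<theta>) x) =
      tensor_map (\<lambda>k. k) (qproj (sq_theta \<theta>)) (rho_tensor x)"
proof -
  have lin: "clinear (\<lambda>x. tensor_map (\<lambda>k. k) (qproj (sq_theta \<theta>)) (rho_tensor x))"
    by (intro tensor_map_clinear all_lin2 qproj_clinear)
  have "tensor_map (\<lambda>k. k) (qproj (sq_theta \<theta>)) (rho_tensor w) = 0" if "w \<in> sq_theta \<theta>" for w
  proof (rule sq_theta_kill[OF lin that])
    fix x y m n m' n'
    assume "bihom x m n" "bihom y m' n'" and s: "mu_theta \<theta> x = 0" "mu_theta \<theta> y = 0"
    then have "bihom (braided_prod \<theta> x y) (m + m') (n + n')" by (intro braided_bihom)
    then show "tensor_map (\<lambda>k. k) (qproj (sq_theta \<theta>)) (rho_tensor (braided_prod \<theta> x y)) = 0"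
      by (simp add: bihom_def tensor_map_tensor[OF clinear_id qproj_clinear] qproj_sq[OF sq_theta_in[OF s]]
         clinear_0[OF tensor_clinear_right])
  qed
  from qlift_clinear[OF lin this] qlift_qproj[OF lin this]
  show "clinear (rho_quot (sq_theta \<theta>))" "rho_quot (sq_theta \<theta>) (qproj (sq_theta \<theta>) x) =
      tensor_map (\<lambda>k. k) (qproj (sq_theta \<theta>)) (rho_tensor x)"
    unfolding rho_quot_def by auto
qed

lemma
  shows delta_quot_clinear: "clinear (delta_quot (sq_theta \<theta>))"
    and delta_quot_qproj: "delta_quot (sq_theta \<theta>) (qproj (sq_theta \<theta>) x) =
      tensor_map (qproj (sq_theta \<theta>)) (\<lambda>h. h) (delta_tensor x)"
proof -
  have lin: "clinear (\<lambda>x. tensor_map (qproj (sq_theta \<theta>)) (\<lambda>h. h) (delta_tensor x))"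
    by (intro tensor_map_clinear all_lin2 qproj_clinear)
  have "tensor_map (qproj (sq_theta \<theta>)) (\<lambda>h. h) (delta_tensor w) = 0" if "w \<in> sq_theta \<theta>" for w
  proof (rule sq_theta_kill[OF lin that])
    fix x y m n m' n'
    assume "bihom x m n" "bihom y m' n'" and s: "mu_theta \<theta> x = 0" "mu_theta \<theta> y = 0"
    then have "bihom (braided_prod \<theta> x y) (m + m') (n + n')" by (intro braided_bihom)
    then show "tensor_map (qproj (sq_theta \<theta>)) (\<lambda>h. h) (delta_tensor (braided_prod \<theta> x y)) = 0"
      by (simp add: bihom_def tensor_map_tensor[OF qproj_clinear clinear_id] qproj_sq[OF sq_theta_in[OF s]]
         clinear_0[OF tensor_clinear_left])
  qed
  from qlift_clinear[OF lin this] qlift_qproj[OF lin this]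
  show "clinear (delta_quot (sq_theta \<theta>))" "delta_quot (sq_theta \<theta>) (qproj (sq_theta \<theta>) x) =
      tensor_map (qproj (sq_theta \<theta>)) (\<lambda>h. h) (delta_tensor x)"
    unfolding delta_quot_def by auto
qed


definition lmul :: "real \<Rightarrow> sphere \<Rightarrow> (sphere, sphere) tensor \<Rightarrow> (sphere, sphere) tensor" where
  "lmul \<theta> a = tensor_lift (\<lambda>b b'. star_prod \<theta> a b \<otimes> b')"

lemma lmul_clinear_right: "clinear g \<Longrightarrow> clinear (\<lambda>x. lmul \<theta> a (g x))"
  and lmul_clinear_left: "clinear g' \<Longrightarrow> clinear (\<lambda>x. lmul \<theta> (g' x) y)"
  unfolding lmul_def by (intro all_lin2; assumption)+

lemmas all_lin3 = all_lin2 lmul_clinear_right lmul_clinear_left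

lemma lmul_tensor: "lmul \<theta> a (b \<otimes> b') = star_prod \<theta> a b \<otimes> b'"
  unfolding lmul_def by (intro tensor_lift_tensor all_lin)

lemma lmul_braided: "lmul \<theta> c (braided_prod \<theta> x y) = braided_prod \<theta> (lmul \<theta> c x) y"
proof (induction c rule: sphere_induct)
  case (homog c m n)
  show ?case
  proof (rule clinear2_homog_eqI[where x = x and y = y]; (intro all_lin3)?)
    fix a a' b b' m1 m2 m3 m4 n1 n2 n3 n4
    assume h: "homog a m1 n1" "homog a' m2 n2" "homog b m3 n3" "homog b' m4 n4"
    show "lmul \<theta> c (braided_prod \<theta> (a \<otimes> a') (b \<otimes> b')) = braided_prod \<theta> (lmul \<theta> c (a \<otimes> a')) (b \<otimes> b')"
      by (simp add: braided_prod_star[OF h] lmul_tensor clinear_simps[OF lmul_clinear_right[OF clinear_id]]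
          braided_prod_star[OF star_prod_homog_closed[OF homog h(1)] h(2-4)] star_prod_assoc)
  qed
qed (simp add: clinear_simps[OF lmul_clinear_left[OF clinear_id]] braided_simps)

lemma mu_theta_lmul: "mu_theta \<theta> (lmul \<theta> c x) = star_prod \<theta> c (mu_theta \<theta> x)"
  by (rule clinear_homog_eqI[where x = x]; (intro all_lin3)?) (simp add: lmul_tensor mu_theta_tensor star_prod_assoc)

lemma
  shows act_theta_clinear: "clinear (act_theta \<theta> a)"
    and act_theta_qproj: "act_theta \<theta> a (qproj (sq_theta \<theta>) x) = qproj (sq_theta \<theta>) (lmul \<theta> a x)"
proof -
  have lin: "clinear (\<lambda>x. qproj (sq_theta \<theta>) (lmul \<theta> a x))"
    by (intro qproj_lin all_lin3)
  have "qproj (sq_theta \<theta>) (lmul \<theta> a w) = 0" if "w \<in> sq_theta \<theta>" for w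
    by (rule sq_theta_kill[OF lin that])
      (auto simp: lmul_braided mu_theta_lmul star_prod_simps intro!: qproj_sq sq_theta_in)
  from qlift_clinear[OF lin this] qlift_qproj[OF lin this]
  show "clinear (act_theta \<theta> a)"
    "act_theta \<theta> a (qproj (sq_theta \<theta>) x) = qproj (sq_theta \<theta>) (lmul \<theta> a x)"
    unfolding act_theta_def kaehler_act_def sq_theta_def lmul_def by auto
qed

lemma
  shows verX_theta_clinear: "clinear (verX_theta \<theta>)"
    and verX_theta_qproj: "verX_theta \<theta> (qproj (sq_theta \<theta>) x) = ver_tensor \<theta> x"
  using qlift_clinear[OF ver_tensor_clinear[OF clinear_id] ver_tensor_sq]
    qlift_qproj[OF ver_tensor_clinear[OF clinear_id] ver_tensor_sq]
  by (simp_all add: verX_theta_def ver_tensor_def)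

lemma d_theta_eq: "d_theta \<theta> a = qproj (sq_theta \<theta>) (1 \<otimes> a - a \<otimes> 1)"
  by (simp add: d_theta_def kaehler_d_def sq_theta_def)

text \<open>\<open>\<bar>ver\<^sup>X\<^sub>\<theta> (a d\<^sub>\<theta>a') = a \<star>\<^sub>\<theta> a'\<^sub>0 X (a'\<^sub>1)\<close>\<close>

lemma verX_theta_d: "verX_theta \<theta> (act_theta \<theta> a (d_theta \<theta> a')) =
    tensor_lift (\<lambda>a0' h. X_H h *\<^sub>C star_prod \<theta> a a0') (delta a')"
proof -
  have "lmul \<theta> a (1 \<otimes> a' - a' \<otimes> 1) = a \<otimes> a' - star_prod \<theta> a a' \<otimes> 1"
    by (simp add: clinear_simps[OF lmul_clinear_right[OF clinear_id]] lmul_tensor star_prod_1)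
  moreover have "ver_tensor \<theta> (a \<otimes> a') = tensor_lift (\<lambda>a0' h. X_H h *\<^sub>C star_prod \<theta> a a0') (delta a')"
    unfolding ver_tensor_def by (rule tensor_lift_tensor[OF cbilinear_ver])
  ultimately show ?thesis
    by (simp add: d_theta_eq act_theta_qproj verX_theta_qproj clinear_simps[OF ver_tensor_clinear[OF clinear_id]]
        ver_tensor_homog[OF homog_1])
qed

text \<open>The classical objects are those for \<open>\<theta> = 0\<close>.\<close>

lemma classical:
  "Omega = Omega_theta 0" "dA = d_theta 0" "actA = act_theta 0" "rho_Omega = rho_Omega_theta 0"
  "delta_Omega = delta_Omega_theta 0" "verX = verX_theta 0" "Con = Con_theta 0"
proof -
  show 1: "Omega = Omega_theta 0" "dA = d_theta 0" "actA = act_theta 0" "rho_Omega = rho_Omega_theta 0"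
    "delta_Omega = delta_Omega_theta 0" "verX = verX_theta 0"
    by (simp_all add: Omega_def Omega_theta_def dA_def d_theta_def actA_def act_theta_def rho_Omega_def
        rho_Omega_theta_def delta_Omega_def delta_Omega_theta_def verX_def verX_theta_def
        star_prod_0 braided_prod_0 sq_theta_0)
  show "Con = Con_theta 0"
    by (simp add: Con_def Con_theta_def 1)
qed

end

(* Rescaling a \<otimes> a' by the cocycle, sigma(a_{-1} \<otimes> a'_{-1}) a_0 \<otimes> a'_0, turns the product of
   A_theta into that of A, and turns braided products of homogeneous elements into scalar
   multiples of the ordinary products. It therefore carries (ker mu_theta)^2 onto (ker mu)^2 and
   induces phi. The same construction for two arbitrary parameters alpha, beta gives bicomodule
   maps in both directions which are mutually inverse on forms; bijectivity on forms and on
   coinvariant forms then follow by symmetry, and the vertical maps are intertwined because the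
   rescaling preserves the U(1)-degree of the second factor. *)
theory Submission
  imports Defs
begin

section \<open>Rescaling by the cocycle\<close>

definition cocycle_twist :: "real \<Rightarrow> (sphere, sphere) tensor \<Rightarrow> (sphere, sphere) tensor" where
  "cocycle_twist \<gamma> = tensor_lift (\<lambda>a a'. tensor_lift (\<lambda>k a0. tensor_lift (\<lambda>k' a0'.
     sigma \<gamma> (k \<otimes> k') *\<^sub>C (a0 \<otimes> a0')) (rho a')) (rho a))"

lemma cocycle_twist_clinear: "clinear g \<Longrightarrow> clinear (\<lambda>x. cocycle_twist \<gamma> (g x))"
  unfolding cocycle_twist_def by (intro all_lin; assumption)

lemmas twist_simps = clinear_simps[OF cocycle_twist_clinear[OF clinear_id]]

lemmas twist_lin = all_lin3 cocycle_twist_clinear qproj_lin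

lemma cocycle_twist_homog:
  assumes "homog a m n" "homog a' m' n'"
  shows "cocycle_twist \<gamma> (a \<otimes> a') = sigma_coeff \<gamma> m m' *\<^sub>C (a \<otimes> a')"
  using assms unfolding cocycle_twist_def homog_def
  by (subst tensor_lift_tensor, (intro all_lin)[1], simp,
      (subst tensor_lift_tensor, (intro all_lin)[1])+, simp add: sigma_tK)

lemma cocycle_twist_inverse: "cocycle_twist (\<beta> - \<alpha>) (cocycle_twist (\<alpha> - \<beta>) x) = x"
proof (rule clinear_homog_eqI[where x = x]; (intro twist_lin)?)
  fix a a' m n m' n' assume h: "homog a m n" "homog a' m' n'"
  have "sigma_coeff (\<alpha> - \<beta>) m m' * sigma_coeff (\<beta> - \<alpha>) m m' = 1"
    by (simp add: sigma_coeff_def algebra_simps flip: exp_add)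
  then show "cocycle_twist (\<beta> - \<alpha>) (cocycle_twist (\<alpha> - \<beta>) (a \<otimes> a')) = a \<otimes> a'"
    by (simp add: cocycle_twist_homog[OF h] twist_simps scaleC_one)
qed

text \<open>The exponent is linear in the parameter, so twisting by
  \<open>\<alpha> - \<beta>\<close> supplies exactly the factor by which the two star products
  differ.\<close>

lemma sigma_coeff_split: "sigma_coeff (\<alpha> - \<beta>) m n * sigma_coeff \<beta> m n = sigma_coeff \<alpha> m n"
  by (simp add: sigma_coeff_def algebra_simps flip: exp_add)

lemma mu_theta_cocycle_twist: "mu_theta \<beta> (cocycle_twist (\<alpha> - \<beta>) x) = mu_theta \<alpha> x"
proof (rule clinear_homog_eqI[where x = x]; (intro twist_lin)?)
  fix a a' m n m' n' assume h: "homog a m n" "homog a' m' n'"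
  show "mu_theta \<beta> (cocycle_twist (\<alpha> - \<beta>) (a \<otimes> a')) = mu_theta \<alpha> (a \<otimes> a')"
    by (simp add: cocycle_twist_homog[OF h] clinear_simps[OF mu_theta_clinear[OF clinear_id]]
        mu_theta_tensor star_prod_homog[OF h] sigma_coeff_split)
qed

text \<open>On homogeneous tensors the vertical map is the product times the degree of the second
  factor, so the computation for \<open>mu_theta\<close> carries over.\<close>

lemma ver_tensor_cocycle_twist: "ver_tensor \<beta> (cocycle_twist (\<alpha> - \<beta>) x) = ver_tensor \<alpha> x"
proof (rule clinear_homog_eqI[where x = x]; (intro twist_lin)?)
  fix a a' m n m' n' assume h: "homog a m n" "homog a' m' n'"
  show "ver_tensor \<beta> (cocycle_twist (\<alpha> - \<beta>) (a \<otimes> a')) = ver_tensor \<alpha> (a \<otimes> a')"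
    by (simp add: cocycle_twist_homog[OF h] clinear_simps[OF ver_tensor_clinear[OF clinear_id]]
        ver_tensor_homog[OF h(2)] star_prod_homog[OF h] mult.left_commute sigma_coeff_split)
qed

section \<open>Compatibility of the twist with the coactions\<close>

lemma rho_tensor_cocycle_twist:
  "rho_tensor (cocycle_twist \<gamma> x) = tensor_map (\<lambda>k. k) (cocycle_twist \<gamma>) (rho_tensor x)"
proof (rule clinear_homog_eqI[where x = x];
    (intro twist_lin tensor_map_clinear cocycle_twist_clinear[OF clinear_id])?)
  fix a a' m n m' n' assume h: "homog a m n" "homog a' m' n'"
  show "rho_tensor (cocycle_twist \<gamma> (a \<otimes> a')) =
      tensor_map (\<lambda>k. k) (cocycle_twist \<gamma>) (rho_tensor (a \<otimes> a'))"
    using bihom_tensor[OF h]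
    by (simp add: bihom_def cocycle_twist_homog[OF h]
        clinear_simps[OF rho_tensor_clinear[OF clinear_id]]
        tensor_map_tensor[OF clinear_id cocycle_twist_clinear[OF clinear_id]] tensor_scale_right)
qed

lemma delta_tensor_cocycle_twist:
  "delta_tensor (cocycle_twist \<gamma> x) = tensor_map (cocycle_twist \<gamma>) (\<lambda>h. h) (delta_tensor x)"
proof (rule clinear_homog_eqI[where x = x];
    (intro twist_lin tensor_map_clinear cocycle_twist_clinear[OF clinear_id])?)
  fix a a' m n m' n' assume h: "homog a m n" "homog a' m' n'"
  show "delta_tensor (cocycle_twist \<gamma> (a \<otimes> a')) =
      tensor_map (cocycle_twist \<gamma>) (\<lambda>h. h) (delta_tensor (a \<otimes> a'))"
    using bihom_tensor[OF h]
    by (simp add: bihom_def cocycle_twist_homog[OF h]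
        clinear_simps[OF delta_tensor_clinear[OF clinear_id]]
        tensor_map_tensor[OF cocycle_twist_clinear[OF clinear_id] clinear_id] tensor_scale_left)
qed

lemma bihom_cocycle_twist: "bihom x m n \<Longrightarrow> bihom (cocycle_twist \<gamma> x) m n"
  by (simp add: bihom_def rho_tensor_cocycle_twist delta_tensor_cocycle_twist
      tensor_map_tensor[OF clinear_id cocycle_twist_clinear[OF clinear_id]]
      tensor_map_tensor[OF cocycle_twist_clinear[OF clinear_id] clinear_id])

section \<open>Braided products and the squared kernels\<close>

lemma twist_coeff:
  "sigma_coeff (\<alpha> - \<beta>) (m1 + m3) (m2 + m4) *
     (R_coeff \<alpha> m3 m2 * sigma_coeff \<alpha> m1 m3 * sigma_coeff \<alpha> m2 m4) =
   sigma_coeff (\<alpha> - \<beta>) (m1 + m2) (m3 + m4) * sigma_coeff (\<alpha> - \<beta>) m1 m2 * sigma_coeff (\<alpha> - \<beta>) m3 m4 *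
     (R_coeff \<beta> m3 m2 * sigma_coeff \<beta> m1 m3 * sigma_coeff \<beta> m2 m4)"
  unfolding sigma_coeff_def R_coeff_def exp_add[symmetric]
  \<comment> \<open>All exponents are multiples of one antisymmetric form on pairs of degrees.
    Because R carries the factor -2, what remains after cancellation is the form on
    \<open>(m3, m2)\<close> plus that on \<open>(m2, m3)\<close>, which is zero.\<close>
  by (rule arg_cong[where f = exp]) (simp add: algebra_simps)

text \<open>The twist need not be multiplicative, but the defect depends only on the total degrees
  of the two tensors and is therefore one scalar for each bihomogeneous pair.\<close>

lemma cocycle_twist_braided:
  assumes "bihom x m n" "bihom y m' n'"
  shows "cocycle_twist (\<alpha> - \<beta>) (braided_prod \<alpha> x y) =
    sigma_coeff (\<alpha> - \<beta>) m m' *\<^sub>C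
      braided_prod \<beta> (cocycle_twist (\<alpha> - \<beta>) x) (cocycle_twist (\<alpha> - \<beta>) y)"
proof -
  \<comment> \<open>A bihomogeneous tensor may mix pure tensors with different degrees in each
    factor. Writing the defect through the coactions makes the identity bilinear, so that it can be
    checked on pure tensors.\<close>
  have "cocycle_twist (\<alpha> - \<beta>) (braided_prod \<alpha> x y) =
      tensor_lift (\<lambda>k x0. tensor_lift (\<lambda>l y0. sigma (\<alpha> - \<beta>) (k \<otimes> l) *\<^sub>C
        braided_prod \<beta> (cocycle_twist (\<alpha> - \<beta>) x0) (cocycle_twist (\<alpha> - \<beta>) y0))
          (rho_tensor y)) (rho_tensor x)" for x y
  proof (rule clinear2_homog_eqI[where x = x and y = y]; (intro twist_lin)?)
    fix a a' b b' m1 m2 m3 m4 n1 n2 n3 n4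
    assume h: "homog a m1 n1" "homog a' m2 n2" "homog b m3 n3" "homog b' m4 n4"
    note r = bihom_tensor[OF h(1,2), unfolded bihom_def, THEN conjunct1]
      bihom_tensor[OF h(3,4), unfolded bihom_def, THEN conjunct1]
    show "cocycle_twist (\<alpha> - \<beta>) (braided_prod \<alpha> (a \<otimes> a') (b \<otimes> b')) =
      tensor_lift (\<lambda>k x0. tensor_lift (\<lambda>l y0. sigma (\<alpha> - \<beta>) (k \<otimes> l) *\<^sub>C
        braided_prod \<beta> (cocycle_twist (\<alpha> - \<beta>) x0) (cocycle_twist (\<alpha> - \<beta>) y0))
          (rho_tensor (b \<otimes> b'))) (rho_tensor (a \<otimes> a'))"
      unfolding r
      by ((subst tensor_lift_tensor, (intro twist_lin)[1])+,
        insert twist_coeff[of \<alpha> \<beta> m1 m3 m2 m4], simp add: braided_prod_homog[OF h] cocycle_twist_homog[OF h(1,2)]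
          cocycle_twist_homog[OF h(3,4)] twist_simps braided_simps sigma_tK
          cocycle_twist_homog[OF homog_mult[OF h(1,3)] homog_mult[OF h(2,4)]] mult_ac)
  qed
  note e = this
  show ?thesis
    using assms unfolding bihom_def e
    by (simp, (subst tensor_lift_tensor, (intro twist_lin)[1])+, simp add: sigma_tK)
qed

text \<open>\<open>sq_theta_kill\<close> reduces to bihomogeneous kernel elements, whose product is
  twisted to a multiple of a product of elements of the other kernel.\<close>

lemma cocycle_twist_sq:
  assumes "w \<in> sq_theta \<alpha>"
  shows "qproj (sq_theta \<beta>) (cocycle_twist (\<alpha> - \<beta>) w) = 0"
proof (rule sq_theta_kill[OF _ assms])
  show "clinear (\<lambda>w. qproj (sq_theta \<beta>) (cocycle_twist (\<alpha> - \<beta>) w))"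
    by (intro twist_lin)
next
  fix x y m n m' n'
  assume b: "bihom x m n" "bihom y m' n'" and "mu_theta \<alpha> x = 0" "mu_theta \<alpha> y = 0"
  then show "qproj (sq_theta \<beta>) (cocycle_twist (\<alpha> - \<beta>) (braided_prod \<alpha> x y)) = 0"
    by (simp add: cocycle_twist_braided[OF b] clinear_simps[OF qproj_clinear] qproj_sq sq_theta_in
        mu_theta_cocycle_twist)
qed

text \<open>\<open>mu_theta\<close> is multiplicative for the braided product. The lemma lets the
  correction term of \<open>transport_tensor\<close> descend to the quotient.\<close>

lemma mu_theta_sq: "w \<in> sq_theta \<theta> \<Longrightarrow> mu_theta \<theta> w = 0"
  by (rule sq_theta_kill[OF mu_theta_clinear[OF clinear_id]])
    (auto simp: mu_theta_braided star_prod_simps)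

section \<open>The induced maps between forms\<close>

text \<open>The summand \<open>mu_theta \<alpha> x \<otimes> 1\<close> vanishes on \<open>ker \<mu>\<close>; it is subtracted because \<open>phi\<close>
  sends the class of every \<open>a \<otimes> a'\<close>, not only of elements of \<open>ker \<mu>\<close>, into \<open>\<Omega>\<^sup>1\<close>.\<close>

definition transport_tensor :: "real \<Rightarrow> real \<Rightarrow> (sphere, sphere) tensor \<Rightarrow> (sphere, sphere) tensor" where
  "transport_tensor \<alpha> \<beta> x = cocycle_twist (\<alpha> - \<beta>) x - mu_theta \<alpha> x \<otimes> 1"

definition transport :: "real \<Rightarrow> real \<Rightarrow> form \<Rightarrow> form" where
  "transport \<alpha> \<beta> = qlift (sq_theta \<alpha>) (\<lambda>x. qproj (sq_theta \<beta>) (transport_tensor \<alpha> \<beta> x))"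

lemma transport_tensor_clinear: "clinear g \<Longrightarrow> clinear (\<lambda>x. transport_tensor \<alpha> \<beta> (g x))"
  unfolding transport_tensor_def by (intro twist_lin; assumption)

lemma
  shows transport_clinear: "clinear (transport \<alpha> \<beta>)"
    and transport_qproj:
      "transport \<alpha> \<beta> (qproj (sq_theta \<alpha>) x) = qproj (sq_theta \<beta>) (transport_tensor \<alpha> \<beta> x)"
proof -
  have lin: "clinear (\<lambda>x. qproj (sq_theta \<beta>) (transport_tensor \<alpha> \<beta> x))"
    by (intro twist_lin transport_tensor_clinear)
  have "qproj (sq_theta \<beta>) (transport_tensor \<alpha> \<beta> w) = 0" if "w \<in> sq_theta \<alpha>" for w
    by (simp add: transport_tensor_def mu_theta_sq[OF that] cocycle_twist_sq[OF that]
        clinear_0[OF tensor_clinear_left])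
  from qlift_clinear[OF lin this] qlift_qproj[OF lin this]
  show "clinear (transport \<alpha> \<beta>)"
    "transport \<alpha> \<beta> (qproj (sq_theta \<alpha>) x) = qproj (sq_theta \<beta>) (transport_tensor \<alpha> \<beta> x)"
    unfolding transport_def by auto
qed

lemma Omega_thetaE:
  assumes "\<omega> \<in> Omega_theta \<theta>"
  obtains x where "\<omega> = qproj (sq_theta \<theta>) x" "mu_theta \<theta> x = 0"
  using assms by (auto simp: Omega_theta_def kaehler_def mu_ker_theta simp flip: sq_theta_def)

lemma Omega_thetaI: "mu_theta \<theta> x = 0 \<Longrightarrow> qproj (sq_theta \<theta>) x \<in> Omega_theta \<theta>"
  by (simp add: Omega_theta_def kaehler_def mu_ker_theta flip: sq_theta_def)

lemma transport_qproj_ker: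
  "mu_theta \<alpha> x = 0 \<Longrightarrow>
    transport \<alpha> \<beta> (qproj (sq_theta \<alpha>) x) = qproj (sq_theta \<beta>) (cocycle_twist (\<alpha> - \<beta>) x)"
  by (simp add: transport_qproj transport_tensor_def clinear_0[OF tensor_clinear_left])

lemma transport_in: "\<omega> \<in> Omega_theta \<alpha> \<Longrightarrow> transport \<alpha> \<beta> \<omega> \<in> Omega_theta \<beta>"
  by (elim Omega_thetaE) (simp add: transport_qproj_ker Omega_thetaI mu_theta_cocycle_twist)

text \<open>The twist preserves the kernel condition, so neither map contributes a correction term.
  The restriction to forms matters: \<open>transport\<close> sends every class of
  \<open>a \<otimes> 1\<close> to zero.\<close>

lemma transport_inverse: "\<omega> \<in> Omega_theta \<alpha> \<Longrightarrow> transport \<beta> \<alpha> (transport \<alpha> \<beta> \<omega>) = \<omega>"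
  by (elim Omega_thetaE)
    (simp add: transport_qproj_ker mu_theta_cocycle_twist cocycle_twist_inverse)

lemma bij_betw_transport: "bij_betw (transport \<alpha> \<beta>) (Omega_theta \<alpha>) (Omega_theta \<beta>)"
  by (rule bij_betw_byWitness[where f' = "transport \<beta> \<alpha>"]) (auto simp: transport_in transport_inverse)

section \<open>Bicomodule compatibility\<close>

lemma bihom_transport_tensor:
  assumes "homog a m n" "homog a' m' n'"
  shows "bihom (transport_tensor \<alpha> \<beta> (a \<otimes> a')) (m + m') (n + n')"
  \<comment> \<open>The unit has degree zero, so the correction term has the same bidegree as the
    twisted tensor.\<close>
  using bihom_diff[OF bihom_cocycle_twist[OF bihom_tensor[OF assms]]
      bihom_tensor[OF star_prod_homog_closed[OF assms] homog_1, simplified]]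
  by (simp add: transport_tensor_def mu_theta_tensor)

lemma rho_transport:
  assumes "\<omega> \<in> Omega_theta \<alpha>"
  shows "rho_Omega_theta \<beta> (transport \<alpha> \<beta> \<omega>) =
    tensor_map (\<lambda>k. k) (transport \<alpha> \<beta>) (rho_Omega_theta \<alpha> \<omega>)"
proof -
  \<comment> \<open>Proved for all classes, not only forms, since the homogeneous pure tensors used
    for checking need not lie in the kernel.\<close>
  have "rho_quot (sq_theta \<beta>) (transport \<alpha> \<beta> (qproj (sq_theta \<alpha>) x)) =
      tensor_map (\<lambda>k. k) (transport \<alpha> \<beta>) (rho_quot (sq_theta \<alpha>) (qproj (sq_theta \<alpha>) x))" for x
    unfolding transport_qproj rho_quot_qproj
  proof (rule clinear_homog_eqI[where x = x];
      (intro twist_lin tensor_map_clinear transport_tensor_clinear transport_clinear qproj_clinear)?)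
    fix a a' m n m' n' assume h: "homog a m n" "homog a' m' n'"
    show "tensor_map (\<lambda>k. k) (qproj (sq_theta \<beta>)) (rho_tensor (transport_tensor \<alpha> \<beta> (a \<otimes> a'))) =
        tensor_map (\<lambda>k. k) (transport \<alpha> \<beta>)
          (tensor_map (\<lambda>k. k) (qproj (sq_theta \<alpha>)) (rho_tensor (a \<otimes> a')))"
      using bihom_tensor[OF h] bihom_transport_tensor[OF h]
      by (simp add: bihom_def tensor_map_tensor[OF clinear_id qproj_clinear]
          tensor_map_tensor[OF clinear_id transport_clinear] transport_qproj)
  qed
  with assms show ?thesis
    by (auto elim!: Omega_thetaE simp: rho_Omega_theta_def)
qed

lemma delta_transport:
  assumes "\<omega> \<in> Omega_theta \<alpha>"
  shows "delta_Omega_theta \<beta> (transport \<alpha> \<beta> \<omega>) =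
    tensor_map (transport \<alpha> \<beta>) (\<lambda>h. h) (delta_Omega_theta \<alpha> \<omega>)"
proof -
  have "delta_quot (sq_theta \<beta>) (transport \<alpha> \<beta> (qproj (sq_theta \<alpha>) x)) =
      tensor_map (transport \<alpha> \<beta>) (\<lambda>h. h) (delta_quot (sq_theta \<alpha>) (qproj (sq_theta \<alpha>) x))" for x
    unfolding transport_qproj delta_quot_qproj
  proof (rule clinear_homog_eqI[where x = x];
      (intro twist_lin tensor_map_clinear transport_tensor_clinear transport_clinear qproj_clinear)?)
    fix a a' m n m' n' assume h: "homog a m n" "homog a' m' n'"
    show "tensor_map (qproj (sq_theta \<beta>)) (\<lambda>h. h) (delta_tensor (transport_tensor \<alpha> \<beta> (a \<otimes> a'))) =
        tensor_map (transport \<alpha> \<beta>) (\<lambda>h. h)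
          (tensor_map (qproj (sq_theta \<alpha>)) (\<lambda>h. h) (delta_tensor (a \<otimes> a')))"
      using bihom_tensor[OF h] bihom_transport_tensor[OF h]
      by (simp add: bihom_def tensor_map_tensor[OF qproj_clinear clinear_id]
          tensor_map_tensor[OF transport_clinear clinear_id] transport_qproj)
  qed
  with assms show ?thesis
    by (auto elim!: Omega_thetaE simp: delta_Omega_theta_def)
qed

section \<open>Connections\<close>

lemma verX_transport:
  "\<omega> \<in> Omega_theta \<alpha> \<Longrightarrow> verX_theta \<beta> (transport \<alpha> \<beta> \<omega>) = verX_theta \<alpha> \<omega>"
  by (elim Omega_thetaE) (simp add: transport_qproj_ker verX_theta_qproj ver_tensor_cocycle_twist)

lemma transport_Con:
  assumes "\<omega> \<in> Con_theta \<alpha>"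
  shows "transport \<alpha> \<beta> \<omega> \<in> Con_theta \<beta>"
  using assms by (simp add: Con_theta_def transport_in verX_transport delta_transport
      tensor_map_tensor[OF transport_clinear clinear_id])

lemma bij_betw_transport_Con: "bij_betw (transport \<alpha> \<beta>) (Con_theta \<alpha>) (Con_theta \<beta>)"
proof (rule bij_betw_byWitness[where f' = "transport \<beta> \<alpha>"])
  have "transport \<beta> \<alpha> (transport \<alpha> \<beta> \<omega>) = \<omega>" if "\<omega> \<in> Con_theta \<alpha>" for \<alpha> \<beta> \<omega>
    using that by (simp add: Con_theta_def transport_inverse)
  then show "\<forall>\<omega>\<in>Con_theta \<alpha>. transport \<beta> \<alpha> (transport \<alpha> \<beta> \<omega>) = \<omega>"
    "\<forall>\<omega>\<in>Con_theta \<beta>. transport \<alpha> \<beta> (transport \<beta> \<alpha> \<omega>) = \<omega>" by blast+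
qed (auto simp: transport_Con)

section \<open>The deformed action\<close>

lemma actA_qproj: "actA a (qproj (sq_theta 0) x) = qproj (sq_theta 0) (lmul 0 a x)"
  by (simp add: classical act_theta_qproj)

text \<open>The representative that \<open>qlift\<close> picks depends only on \<open>l\<close>; for
  this fixed representative the action is linear in the algebra element.\<close>

lemma actA_clinear_left: "clinear g \<Longrightarrow> clinear (\<lambda>x. actA (g x) l)"
  unfolding actA_def kaehler_act_def qlift_def
  by (rule clinear_compose[OF qproj_clinear]) (intro all_lin; assumption)

lemma actA_clinear_right: "clinear g \<Longrightarrow> clinear (\<lambda>x. actA a (g x))"
  unfolding classical by (rule clinear_compose[OF act_theta_clinear])

lemma rho_Omega_clinear: "clinear g \<Longrightarrow> clinear (\<lambda>x. rho_Omega (g x))"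
  unfolding classical rho_Omega_theta_def by (rule clinear_compose[OF rho_quot_clinear])

lemmas act_lin = twist_lin actA_clinear_left actA_clinear_right rho_Omega_clinear

lemma twist_act_clinear_left: "clinear g \<Longrightarrow> clinear (\<lambda>x. twist_act \<theta> (g x) \<xi>)"
  and twist_act_clinear_right: "clinear g' \<Longrightarrow> clinear (\<lambda>x. twist_act \<theta> a (g' x))"
  unfolding twist_act_def by (intro act_lin; assumption)+

lemma twist_act_bihom:
  assumes "homog a m n" "bihom x m' n'"
  shows "twist_act \<theta> a (qproj (sq_theta 0) x) =
    sigma_coeff \<theta> m m' *\<^sub>C qproj (sq_theta 0) (lmul 0 a x)"
proof -
  have "rho_Omega (qproj (sq_theta 0) x) = tK m' \<otimes> qproj (sq_theta 0) x"
    using assms(2) by (simp add: classical rho_Omega_theta_def rho_quot_qproj bihom_def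
        tensor_map_tensor[OF clinear_id qproj_clinear])
  with assms(1) show ?thesis
    unfolding twist_act_def homog_def
    by (simp, (subst tensor_lift_tensor, (intro act_lin)[1])+, simp add: sigma_tK actA_qproj)
qed

text \<open>On homogeneous elements this is the 2-cocycle identity: both scalars equal the product
  of \<open>sigma_coeff\<close> over the three pairs of degrees.\<close>

lemma twist_act_cocycle_twist:
  "twist_act \<theta> a (qproj (sq_theta 0) (cocycle_twist \<theta> x)) =
    qproj (sq_theta 0) (cocycle_twist \<theta> (lmul \<theta> a x))"
proof (induction a rule: sphere_induct)
  case (homog a m n)
  show ?case
  proof (rule clinear_homog_eqI[where x = x]; (intro twist_lin twist_act_clinear_right)?)
    fix b b' k l k' l' assume h: "homog b k l" "homog b' k' l'"
    show "twist_act \<theta> a (qproj (sq_theta 0) (cocycle_twist \<theta> (b \<otimes> b'))) =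
        qproj (sq_theta 0) (cocycle_twist \<theta> (lmul \<theta> a (b \<otimes> b')))"
      by (simp add: cocycle_twist_homog[OF h] twist_act_bihom[OF homog bihom_tensor[OF h]]
          clinear_simps[OF qproj_clinear] clinear_simps[OF twist_act_clinear_right[OF clinear_id]]
          lmul_tensor star_prod_0 star_prod_homog[OF homog h(1)] tensor_scale_left twist_simps
          cocycle_twist_homog[OF homog_mult[OF homog h(1)] h(2)] sigma_coeff_add mult_ac)
  qed
qed (simp add: clinear_simps[OF twist_act_clinear_left[OF clinear_id]]
    clinear_simps[OF lmul_clinear_left[OF clinear_id]] twist_simps clinear_simps[OF qproj_clinear])

section \<open>Differentials and the identification of \<open>phi\<close>\<close>

lemma cocycle_twist_right_1: "cocycle_twist \<gamma> (a \<otimes> 1) = a \<otimes> 1"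
  by (induction a rule: sphere_induct)
    (simp_all add: cocycle_twist_homog[OF _ homog_1] sigma_coeff_add scaleC_one tensor_add_left twist_simps)

lemma cocycle_twist_left_1: "cocycle_twist \<gamma> (1 \<otimes> a) = 1 \<otimes> a"
  by (induction a rule: sphere_induct)
    (simp_all add: cocycle_twist_homog[OF homog_1] sigma_coeff_add scaleC_one tensor_add_right twist_simps)

text \<open>Presents \<open>dA a\<close> as the class of a twisted tensor, the form in which
  \<open>twist_act_cocycle_twist\<close> applies.\<close>

lemma dA_cocycle_twist: "dA a = qproj (sq_theta 0) (cocycle_twist \<theta> (1 \<otimes> a - a \<otimes> 1))"
  by (simp add: classical d_theta_eq twist_simps cocycle_twist_right_1 cocycle_twist_left_1)

lemma lmul_d: "lmul \<theta> a (1 \<otimes> a' - a' \<otimes> 1) = a \<otimes> a' - star_prod \<theta> a a' \<otimes> 1"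
  by (simp add: clinear_simps[OF lmul_clinear_right[OF clinear_id]] lmul_tensor star_prod_1)

text \<open>The correction term of \<open>transport_tensor\<close> originates here: it is the second
  summand in \<open>lmul_d\<close>, which the twist fixes.\<close>

lemma twist_act_dA:
  "twist_act \<theta> a (dA a') = qproj (sq_theta 0) (transport_tensor \<theta> 0 (a \<otimes> a'))"
  unfolding dA_cocycle_twist[of _ \<theta>] twist_act_cocycle_twist lmul_d
  by (simp add: twist_simps cocycle_twist_right_1 transport_tensor_def mu_theta_tensor)

text \<open>Both maps are induced by linear maps that agree on pure tensors, so they coincide on the
  whole ambient space.\<close>

lemma phi_eq_transport: "phi \<theta> = transport \<theta> 0"
proof -
  have "cbilinear (\<lambda>a a'. qproj (sq_theta 0) (transport_tensor \<theta> 0 (a \<otimes> a')))"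
    by (intro twist_lin transport_tensor_clinear)
  note lift = tensor_lift_tensor[OF this] tensor_lift_clinear[OF this]
  have "tensor_lift (\<lambda>a a'. twist_act \<theta> a (dA a')) x = qproj (sq_theta 0) (transport_tensor \<theta> 0 x)" for x
    unfolding twist_act_dA
    by (rule clinear_tensor_eqI[where x = x]) (intro lift twist_lin transport_tensor_clinear)+
  then have "tensor_lift (\<lambda>a a'. twist_act \<theta> a (dA a')) =
      (\<lambda>x. qproj (sq_theta 0) (transport_tensor \<theta> 0 x))" ..
  then show ?thesis
    by (simp only: phi_def transport_def)
qed

lemma transport_act:
  assumes "\<omega> \<in> Omega_theta \<theta>"
  shows "transport \<theta> 0 (act_theta \<theta> a \<omega>) = twist_act \<theta> a (transport \<theta> 0 \<omega>)"
  using assms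
proof (rule Omega_thetaE)
  fix x assume x: "\<omega> = qproj (sq_theta \<theta>) x" "mu_theta \<theta> x = 0"
  \<comment> \<open>The action preserves the kernel, so \<open>transport\<close> is the bare twist
    on both sides.\<close>
  then have "mu_theta \<theta> (lmul \<theta> a x) = 0"
    by (simp add: mu_theta_lmul star_prod_simps)
  then show ?thesis
    using x twist_act_cocycle_twist by (simp add: act_theta_qproj transport_qproj_ker)
qed

text \<open>The classical objects are those with parameter 0, so the claims are the case
  \<open>\<beta> = 0\<close> of the results on \<open>transport\<close>.\<close>

theorem proposition4p9:
  fixes \<theta> :: real
  shows "form_iso \<theta> (phi \<theta>) \<and>
    (\<forall>a a'. phi \<theta> (act_theta \<theta> a (d_theta \<theta> a')) = twist_act \<theta> a (dA a')) \<and>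
    bij_betw (phi \<theta>) (Con_theta \<theta>) Con"
proof (intro conjI allI)
  show "form_iso \<theta> (phi \<theta>)"
    unfolding form_iso_def phi_eq_transport classical
    by (simp add: transport_clinear bij_betw_transport transport_act rho_transport delta_transport)
  show "bij_betw (phi \<theta>) (Con_theta \<theta>) Con"
    unfolding phi_eq_transport classical by (rule bij_betw_transport_Con)
  fix a a'
  have "mu_theta \<theta> (a \<otimes> a' - star_prod \<theta> a a' \<otimes> 1) = 0"
    by (simp add: clinear_simps[OF mu_theta_clinear[OF clinear_id]] mu_theta_tensor star_prod_1)
  then show "phi \<theta> (act_theta \<theta> a (d_theta \<theta> a')) = twist_act \<theta> a (dA a')"
    by (simp add: phi_eq_transport d_theta_eq act_theta_qproj lmul_d transport_qproj_ker
        twist_act_dA twist_simps cocycle_twist_right_1 transport_tensor_def mu_theta_tensor)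
qed

end
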